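(* Let $(W,S)$ be a finite Coxeter system, $c$ a Coxeter element with reduced word $\mathbf{c}$, $s$ an initial letter of $c$, and $c'=scs$ with reduced word $\mathbf{c}'$. Let $\beta_1,\beta_2\in\Phi_{\geq-1}$. Then $\{\beta_1,\beta_2\}$ is a face of $\Delta(\mathbf{c}\mathbf{w}_\circ(\mathbf{c}),w_\circ)$ (positions identified with $\Phi_{\geq-1}$ via $\mathsf{Lr}_c$) if and only if $\{\sigma_s(\beta_1),\sigma_s(\beta_2)\}$ is a face of $\Delta(\mathbf{c}'\mathbf{w}_\circ(\mathbf{c}'),w_\circ)$ (positions identified with $\Phi_{\geq-1}$ via $\mathsf{Lr}_{c'}$).
   Context: $s$ is initial in $c$ if $\ell(sc)<\ell(c)$. $W$ acts on $V$ with simple roots $\{\alpha_t\}$, root system $\Phi$, positive roots $\Phi^+$, and $\Phi_{\geq-1}=\Phi^+\cup\{-\alpha_t:t\in S\}$. The involution $\sigma_s$ of $\Phi_{\geq-1}$ is $\sigma_s(\beta)=\beta$ if $-\beta\in\{\alpha_t : t\neq s\}$, and $\sigma_s(\beta)=s(\beta)$ otherwise. $w_\circ$ is the longest element, $N=\ell(w_\circ)$. For a Coxeter element $d$ with reduced word $\mathbf{d}=(d_1,\dots,d_n)$, $\mathbf{w}_\circ(\mathbf{d})=(w_1,\dots,w_N)$ is the lexicographically first (as a sequence of positions) subword of $\mathbf{d}\mathbf{d}\cdots$ which is a reduced expression for $w_\circ$, and $\mathsf{Lr}_d$ is the bijection from positions of $(d_1,\dots,d_n,w_1,\dots,w_N)$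 to $\Phi_{\geq-1}$ sending $d_i\mapsto-\alpha_{d_i}$ and $w_i\mapsto w_1\cdots w_{i-1}(\alpha_{w_i})$. For a word $Q$ and $\pi\in W$, $\Delta(Q,\pi)$ is the simplicial complex on the positions of $Q$ whose faces are the sets $P$ of positions such that deleting them leaves a word containing a reduced expression for $\pi$ as a subword. *)

theory Defs
  imports
    "HOL-Analysis.Analysis"
    "HOL-Algebra.Group_Action"
    "HOL-Algebra.Generated_Groups"
    "HOL-Library.Sublist"
begin

definition word_prod :: "('a, 'b) monoid_scheme \<Rightarrow> 'a list \<Rightarrow> 'a" where
  "word_prod W ws = foldr (\<otimes>\<^bsub>W\<^esub>) ws \<one>\<^bsub>W\<^esub>"

text \<open>The entry 0 encodes \<open>m(s,t) = \<infinity>\<close>.\<close>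

definition coxeter_matrix :: "'a set \<Rightarrow> ('a \<Rightarrow> 'a \<Rightarrow> nat) \<Rightarrow> bool" where
  "coxeter_matrix S m \<longleftrightarrow>
     (\<forall>s\<in>S. m s s = 1) \<and> (\<forall>s\<in>S. \<forall>t\<in>S. m s t = m t s \<and> (s \<noteq> t \<longrightarrow> m s t \<noteq> 1))"

text \<open>The congruence on words generated by the relations \<open>(st)\<^bsup>m(s,t)\<^esup> = 1\<close>. Since
  \<open>m(s,s) = 1\<close> makes every generator its own inverse, the monoid presented in this way
  is the group with the same presentation.\<close>

inductive coxeter_equiv :: "'a set \<Rightarrow> ('a \<Rightarrow> 'a \<Rightarrow> nat) \<Rightarrow> 'a list \<Rightarrow> 'a list \<Rightarrow> bool"
  for S m where
  rel: "s \<in> S \<Longrightarrow> t \<in> S \<Longrightarrow>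
          coxeter_equiv S m (u @ concat (replicate (m s t) [s, t]) @ v) (u @ v)"
| refl: "coxeter_equiv S m u u"
| sym: "coxeter_equiv S m u v \<Longrightarrow> coxeter_equiv S m v u"
| trans: "coxeter_equiv S m u v \<Longrightarrow> coxeter_equiv S m v w \<Longrightarrow> coxeter_equiv S m u w"

definition coxeter_system :: "('a, 'b) monoid_scheme \<Rightarrow> 'a set \<Rightarrow> bool" where
  "coxeter_system W S \<longleftrightarrow>
     group W \<and> S \<subseteq> carrier W \<and> generate W S = carrier W \<and>
     (\<exists>m. coxeter_matrix S m \<and>
        (\<forall>u\<in>lists S. \<forall>v\<in>lists S. word_prod W u = word_prod W v \<longleftrightarrow> coxeter_equiv S m u v))"

definition finite_coxeter_system :: "('a, 'b) monoid_scheme \<Rightarrow> 'a set \<Rightarrow> bool" where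
  "finite_coxeter_system W S \<longleftrightarrow> coxeter_system W S \<and> finite (carrier W)"

definition cox_length :: "('a, 'b) monoid_scheme \<Rightarrow> 'a set \<Rightarrow> 'a \<Rightarrow> nat" where
  "cox_length W S w = (LEAST k. \<exists>ws\<in>lists S. length ws = k \<and> word_prod W ws = w)"

definition reduced_word :: "('a, 'b) monoid_scheme \<Rightarrow> 'a set \<Rightarrow> 'a list \<Rightarrow> 'a \<Rightarrow> bool" where
  "reduced_word W S ws w \<longleftrightarrow>
     ws \<in> lists S \<and> word_prod W ws = w \<and> length ws = cox_length W S w"

definition longest_element :: "('a, 'b) monoid_scheme \<Rightarrow> 'a set \<Rightarrow> 'a" where
  "longest_element W S =
     (THE w. w \<in> carrier W \<and> (\<forall>u\<in>carrier W. cox_length W S u \<le> cox_length W S w))"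

definition coxeter_element :: "('a, 'b) monoid_scheme \<Rightarrow> 'a set \<Rightarrow> 'a \<Rightarrow> bool" where
  "coxeter_element W S c \<longleftrightarrow> (\<exists>ws. distinct ws \<and> set ws = S \<and> word_prod W ws = c)"

definition initial_letter :: "('a, 'b) monoid_scheme \<Rightarrow> 'a set \<Rightarrow> 'a \<Rightarrow> 'a \<Rightarrow> bool" where
  "initial_letter W S s c \<longleftrightarrow> s \<in> S \<and> cox_length W S (s \<otimes>\<^bsub>W\<^esub> c) < cox_length W S c"

definition reflection :: "'v::euclidean_space \<Rightarrow> 'v \<Rightarrow> 'v" where
  "reflection a v = v - (2 * (v \<bullet> a) / (a \<bullet> a)) *\<^sub>R a"

text \<open>Reduced root systems of finite reflection groups, not necessarily crystallographic
  and not necessarily spanning the ambient space.\<close>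

definition root_system :: "'v::euclidean_space set \<Rightarrow> bool" where
  "root_system \<Phi> \<longleftrightarrow>
     finite \<Phi> \<and> 0 \<notin> \<Phi> \<and> (\<forall>a\<in>\<Phi>. \<Phi> \<inter> span {a} = {a, - a} \<and> reflection a ` \<Phi> = \<Phi>)"

definition pos_roots :: "'a set \<Rightarrow> ('a \<Rightarrow> 'v::euclidean_space) \<Rightarrow> 'v set \<Rightarrow> 'v set" where
  "pos_roots S \<alpha> \<Phi> = {\<beta>\<in>\<Phi>. \<exists>k. (\<forall>t\<in>S. 0 \<le> k t) \<and> \<beta> = (\<Sum>t\<in>S. k t *\<^sub>R \<alpha> t)}"

definition simple_roots :: "'a set \<Rightarrow> ('a \<Rightarrow> 'v::euclidean_space) \<Rightarrow> 'v set \<Rightarrow> bool" where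
  "simple_roots S \<alpha> \<Phi> \<longleftrightarrow>
     inj_on \<alpha> S \<and> \<alpha> ` S \<subseteq> \<Phi> \<and> independent (\<alpha> ` S) \<and>
     (\<forall>\<beta>\<in>\<Phi>. \<beta> \<in> pos_roots S \<alpha> \<Phi> \<or> - \<beta> \<in> pos_roots S \<alpha> \<Phi>)"

text \<open>\<open>W\<close> acts on \<open>V\<close> as a finite reflection group with root system \<open>\<Phi>\<close>, each \<open>t \<in> S\<close>
  acting as the reflection in the simple root \<open>\<alpha> t\<close>. Faithfulness ensures that \<open>\<Phi>\<close> is a
  root system of \<open>W\<close> itself and not of a proper quotient.\<close>

definition reflection_action ::
  "('a, 'b) monoid_scheme \<Rightarrow> 'a set \<Rightarrow> ('a \<Rightarrow> 'v \<Rightarrow> 'v) \<Rightarrow> ('a \<Rightarrow> 'v::euclidean_space) \<Rightarrow> 'v set \<Rightarrow> bool"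
where
  "reflection_action W S act \<alpha> \<Phi> \<longleftrightarrow>
     root_system \<Phi> \<and> simple_roots S \<alpha> \<Phi> \<and>
     faithful_action W UNIV act \<and> (\<forall>t\<in>S. act t = reflection (\<alpha> t))"

definition almost_pos_roots :: "'a set \<Rightarrow> ('a \<Rightarrow> 'v::euclidean_space) \<Rightarrow> 'v set \<Rightarrow> 'v set" where
  "almost_pos_roots S \<alpha> \<Phi> = pos_roots S \<alpha> \<Phi> \<union> {- \<alpha> t | t. t \<in> S}"

definition root_sigma ::
  "'a set \<Rightarrow> ('a \<Rightarrow> 'v \<Rightarrow> 'v) \<Rightarrow> ('a \<Rightarrow> 'v::euclidean_space) \<Rightarrow> 'a \<Rightarrow> 'v \<Rightarrow> 'v" where
  "root_sigma S act \<alpha> s \<beta> = (if - \<beta> \<in> {\<alpha> t | t. t \<in> S \<and> t \<noteq> s} then \<beta> else act s \<beta>)"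

text \<open>Positions in words are counted from 0. The letter of the infinite word \<open>d d d \<dots>\<close>
  at position \<open>i\<close> is \<open>d ! (i mod length d)\<close>.\<close>

definition longest_positions ::
  "('a, 'b) monoid_scheme \<Rightarrow> 'a set \<Rightarrow> 'a list \<Rightarrow> nat list \<Rightarrow> bool" where
  "longest_positions W S d ps \<longleftrightarrow>
     sorted_wrt (<) ps \<and>
     reduced_word W S (map (\<lambda>i. d ! (i mod length d)) ps) (longest_element W S)"

definition sorting_positions :: "('a, 'b) monoid_scheme \<Rightarrow> 'a set \<Rightarrow> 'a list \<Rightarrow> nat list" where
  "sorting_positions W S d =
     (THE ps. longest_positions W S d ps \<and>
        (\<forall>qs. longest_positions W S d qs \<longrightarrow> ps = qs \<or> (ps, qs) \<in> lexord less_than))"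

definition sorting_word :: "('a, 'b) monoid_scheme \<Rightarrow> 'a set \<Rightarrow> 'a list \<Rightarrow> 'a list" where
  "sorting_word W S d = map (\<lambda>i. d ! (i mod length d)) (sorting_positions W S d)"

definition Lr ::
  "('a, 'b) monoid_scheme \<Rightarrow> 'a set \<Rightarrow> ('a \<Rightarrow> 'v \<Rightarrow> 'v) \<Rightarrow> ('a \<Rightarrow> 'v::euclidean_space) \<Rightarrow>
     'a list \<Rightarrow> nat \<Rightarrow> 'v" where
  "Lr W S act \<alpha> d i =
     (if i < length d then - \<alpha> (d ! i)
      else let w = sorting_word W S d; j = i - length d
           in act (word_prod W (take j w)) (\<alpha> (w ! j)))"

definition subword_complex ::
  "('a, 'b) monoid_scheme \<Rightarrow> 'a set \<Rightarrow> 'a list \<Rightarrow> 'a \<Rightarrow> nat set set" where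
  "subword_complex W S Q \<pi> =
     {P. P \<subseteq> {..<length Q} \<and> (\<exists>u. reduced_word W S u \<pi> \<and> subseq u (nths Q (- P)))}"

text \<open>The complex of the word \<open>d w\<^sub>\<circ>(d)\<close> for the longest element, with positions
  identified with almost positive roots.\<close>

definition root_subword_complex ::
  "('a, 'b) monoid_scheme \<Rightarrow> 'a set \<Rightarrow> ('a \<Rightarrow> 'v \<Rightarrow> 'v) \<Rightarrow> ('a \<Rightarrow> 'v::euclidean_space) \<Rightarrow>
     'a list \<Rightarrow> 'v set set" where
  "root_subword_complex W S act \<alpha> d =
     (\<lambda>P. Lr W S act \<alpha> d ` P) `
       subword_complex W S (d @ sorting_word W S d) (longest_element W S)"

end

theory Submission
  imports Defs
begin

text \<open>Rotating the first letter \<open>s\<close> of a word to its end as \<open>w\<^sub>\<circ> s w\<^sub>\<circ>\<close> preserves the property of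
  containing a reduced word for \<open>w\<^sub>\<circ>\<close>, and exchanging adjacent commuting letters preserves it
  too. If \<open>c = s d\<close>, rotating \<open>c w\<^sub>\<circ>(c)\<close> changes the root labels by \<open>\<sigma>\<^sub>s\<close>, so what has to be
  shown is that the result is \<open>c' w\<^sub>\<circ>(c')\<close> up to commutations, where \<open>c' = d s\<close>.

  This is controlled by the skew-symmetric form \<open>\<omega>\<^sub>c\<close> with
  \<open>\<omega>\<^sub>c(\<alpha>\<^sub>s, \<alpha>\<^sub>t) = - \<langle>\<alpha>\<^sub>s, \<alpha>\<^sub>t\<rangle>\<close> for \<open>s\<close> before \<open>t\<close> in \<open>c\<close>, which satisfies
  \<open>\<omega>\<^bsub>c'\<^esub>(s x, s y) = \<omega>\<^sub>c(x, y)\<close> and is nonnegative on \<open>(\<alpha>\<^sub>s, \<beta>)\<close> for \<open>s\<close> initial and \<open>\<beta>\<close>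
  positive. Applying the letters of \<open>ccc\<dots>\<close> one by one to a positive root, call the root dead
  once it has become negative. A root that dies earlier pairs nonnegatively with one that dies
  later, and a zero pairing forces orthogonality; from this, the greedy reduced subword of
  \<open>ccc\<dots>\<close> lists the positive roots in the order in which they die. Hence any two orders of
  the positive roots that are compatible with \<open>\<omega>\<^sub>c\<close> differ only in orthogonal pairs, and the
  corresponding words only by commutations.\<close>

subsection \<open>Reflections\<close>

text \<open>Since \<open>x / 0 = 0\<close>, \<open>reflection 0\<close> is the identity.\<close>

lemma orthogonal_transformation_reflection: "orthogonal_transformation (reflection a)"
proof -
  have "linear (reflection a)"
    unfolding reflection_def
    by (rule linearI) (auto simp: inner_add_left algebra_simps add_divide_distrib)
  moreover have "reflection a u \<bullet> reflection a v = u \<bullet> v" for u v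
    unfolding reflection_def
    by (cases "a = 0") (simp_all add: inner_diff_left inner_diff_right field_simps inner_commute)
  ultimately show ?thesis
    by (simp add: orthogonal_transformation_def)
qed

lemma reflection_reflection [simp]: "reflection a (reflection a v) = v"
  unfolding reflection_def by (cases "a = 0") (simp_all add: inner_diff_left field_simps)

lemma reflection_self [simp]: "reflection a a = - a"
  unfolding reflection_def by (cases "a = 0") (simp_all add: scaleR_2)

lemma reflection_minus [simp]: "reflection a (- v) = - reflection a v"
  unfolding reflection_def by simp

lemma inner_reflection_reflection [simp]: "reflection a u \<bullet> reflection a v = u \<bullet> v"
  using orthogonal_transformation_reflection[of a] by (simp add: orthogonal_transformation_def)

lemma reflection_eq_iff: "reflection a u = v \<longleftrightarrow> u = reflection a v"
  by (metis reflection_reflection)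

lemma inj_reflection: "inj_on (reflection a) A"
  by (rule inj_onI) (simp add: reflection_eq_iff)

lemma reflection_orthogonal: "v \<bullet> a = 0 \<Longrightarrow> reflection a v = v"
  unfolding reflection_def by simp

lemma reflection_conjugate:
  assumes "orthogonal_transformation f"
  shows "reflection (f a) (f v) = f (reflection a v)"
  using assms unfolding reflection_def orthogonal_transformation_def
  by (simp add: linear_diff linear_scale)

lemma reflection_commute:
  assumes "a \<bullet> b = 0"
  shows "reflection a (reflection b v) = reflection b (reflection a v)"
  using reflection_conjugate[OF orthogonal_transformation_reflection, of a b v] assms
  by (simp add: reflection_orthogonal inner_commute)

subsection \<open>Root systems with a basis of simple roots\<close>

locale root_basis =
  fixes S :: "'a set" and \<alpha> :: "'a \<Rightarrow> 'v::euclidean_space" and \<Phi> :: "'v set"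
  assumes root_system: "root_system \<Phi>"
    and simple_roots: "simple_roots S \<alpha> \<Phi>"
begin

abbreviation positive_roots :: "'v set" (\<open>\<Phi>\<^sub>+\<close>) where
  "\<Phi>\<^sub>+ \<equiv> pos_roots S \<alpha> \<Phi>"

abbreviation srefl :: "'a \<Rightarrow> 'v \<Rightarrow> 'v" where
  "srefl x \<equiv> reflection (\<alpha> x)"

lemma inj_on_simple: "inj_on \<alpha> S"
  and simple_root [simp]: "t \<in> S \<Longrightarrow> \<alpha> t \<in> \<Phi>"
  and independent_simple: "independent (\<alpha> ` S)"
  and pos_or_neg: "b \<in> \<Phi> \<Longrightarrow> b \<in> \<Phi>\<^sub>+ \<or> - b \<in> \<Phi>\<^sub>+"
  using simple_roots unfolding simple_roots_def by auto

lemma finite_roots: "finite \<Phi>"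
  and root_nonzero: "b \<in> \<Phi> \<Longrightarrow> b \<noteq> 0"
  and roots_on_line: "a \<in> \<Phi> \<Longrightarrow> \<Phi> \<inter> span {a} = {a, - a}"
  and reflection_roots: "a \<in> \<Phi> \<Longrightarrow> reflection a ` \<Phi> = \<Phi>"
  using root_system unfolding root_system_def by auto

lemma simple_nonzero [simp]: "t \<in> S \<Longrightarrow> \<alpha> t \<noteq> 0"
  using root_nonzero by simp

lemma finite_S [simp]: "finite S"
  using independent_simple inj_on_simple independent_imp_finite finite_imageD by blast

lemma simple_eq_iff [simp]: "s \<in> S \<Longrightarrow> t \<in> S \<Longrightarrow> \<alpha> s = \<alpha> t \<longleftrightarrow> s = t"
  using inj_on_simple by (auto dest: inj_onD)

lemma neg_root [simp]: "b \<in> \<Phi> \<Longrightarrow> - b \<in> \<Phi>"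
  using roots_on_line by blast

lemma pos_root: "b \<in> \<Phi>\<^sub>+ \<Longrightarrow> b \<in> \<Phi>"
  by (simp add: pos_roots_def)

lemma finite_pos_roots [simp]: "finite \<Phi>\<^sub>+"
  using finite_roots by (simp add: pos_roots_def)

lemma root_in_span: "b \<in> \<Phi> \<Longrightarrow> b \<in> span (\<alpha> ` S)"
proof -
  have pos: "b \<in> span (\<alpha> ` S)" if "b \<in> \<Phi>\<^sub>+" for b
    using that unfolding pos_roots_def by (auto intro: span_sum span_scale span_base)
  show "b \<in> \<Phi> \<Longrightarrow> b \<in> span (\<alpha> ` S)"
    using pos pos_or_neg span_neg by fastforce
qed

lemma srefl_root [simp]: "t \<in> S \<Longrightarrow> b \<in> \<Phi> \<Longrightarrow> srefl t b \<in> \<Phi>"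
  using reflection_roots[of "\<alpha> t"] simple_root[of t] imageI[of b \<Phi> "srefl t"] by metis

definition coord :: "'a \<Rightarrow> 'v \<Rightarrow> real" where
  "coord t = construct (\<alpha> ` S) (\<lambda>b. of_bool (b = \<alpha> t))"

lemma linear_coord: "linear (coord t)"
  unfolding coord_def by (rule real_vector.linear_construct[OF independent_simple])

lemma coord_simple [simp]: "s \<in> S \<Longrightarrow> t \<in> S \<Longrightarrow> coord t (\<alpha> s) = of_bool (s = t)"
  unfolding coord_def by (simp add: real_vector.construct_basis[OF independent_simple])

lemma coord_minus [simp]: "coord t (- v) = - coord t v"
  and coord_add: "coord t (u + v) = coord t u + coord t v"
  and coord_scaleR: "coord t (k *\<^sub>R v) = k * coord t v"
  and coord_sum: "coord t (\<Sum>i\<in>A. f i) = (\<Sum>i\<in>A. coord t (f i))"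
  using linear_coord[of t] by (simp_all add: linear_neg linear_add linear_scale linear_sum)

lemma coord_expansion:
  assumes "v \<in> span (\<alpha> ` S)"
  shows "v = (\<Sum>t\<in>S. coord t v *\<^sub>R \<alpha> t)"
proof -
  have "linear (\<lambda>v. \<Sum>t\<in>S. coord t v *\<^sub>R \<alpha> t)"
    by (rule linearI)
      (simp_all add: coord_add coord_scaleR scaleR_left_distrib sum.distrib scaleR_sum_right)
  moreover have "b = (\<Sum>t\<in>S. coord t b *\<^sub>R \<alpha> t)" if "b \<in> \<alpha> ` S" for b
  proof -
    obtain s where s: "s \<in> S" "b = \<alpha> s"
      using \<open>b \<in> \<alpha> ` S\<close> by blast
    have "(\<Sum>t\<in>S. coord t b *\<^sub>R \<alpha> t) = (\<Sum>t\<in>S. if s = t then \<alpha> t else 0)"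
      using s by (intro sum.cong) auto
    then show ?thesis
      using s by simp
  qed
  ultimately show ?thesis
    using linear_eq_on[OF linear_id[unfolded id_def] _ assms] by blast
qed

lemma pos_root_iff: "b \<in> \<Phi>\<^sub>+ \<longleftrightarrow> b \<in> \<Phi> \<and> (\<forall>t\<in>S. 0 \<le> coord t b)"
proof
  assume "b \<in> \<Phi>\<^sub>+"
  then obtain k where k: "b \<in> \<Phi>" "\<forall>t\<in>S. 0 \<le> k t" "b = (\<Sum>t\<in>S. k t *\<^sub>R \<alpha> t)"
    unfolding pos_roots_def by blast
  have "coord t b = k t" if "t \<in> S" for t
    unfolding k(3) coord_sum coord_scaleR using that by (simp add: sum.delta')
  then show "b \<in> \<Phi> \<and> (\<forall>t\<in>S. 0 \<le> coord t b)"
    using k by simp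
next
  assume "b \<in> \<Phi> \<and> (\<forall>t\<in>S. 0 \<le> coord t b)"
  then show "b \<in> \<Phi>\<^sub>+"
    unfolding pos_roots_def
    by (intro CollectI conjI exI[of _ "\<lambda>t. coord t b"] coord_expansion root_in_span) simp_all
qed

lemma coord_nonneg: "b \<in> \<Phi>\<^sub>+ \<Longrightarrow> t \<in> S \<Longrightarrow> 0 \<le> coord t b"
  by (simp add: pos_root_iff)

lemma simple_pos [simp]: "t \<in> S \<Longrightarrow> \<alpha> t \<in> \<Phi>\<^sub>+"
  by (simp add: pos_root_iff)

lemma root_has_coord:
  assumes "b \<in> \<Phi>"
  shows "\<exists>t\<in>S. coord t b \<noteq> 0"
proof (rule ccontr)
  assume none: "\<not> ?thesis"
  have "b = (\<Sum>t\<in>S. coord t b *\<^sub>R \<alpha> t)"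
    using root_in_span[OF assms] by (rule coord_expansion)
  also have "\<dots> = 0"
    using none by simp
  finally show False
    using root_nonzero[OF assms] by contradiction
qed

lemma neg_not_pos: "b \<in> \<Phi>\<^sub>+ \<Longrightarrow> - b \<notin> \<Phi>\<^sub>+"
  by (metis coord_minus coord_nonneg neg_0_le_iff_le order_antisym pos_root root_has_coord)

lemma neg_pos_iff: "b \<in> \<Phi> \<Longrightarrow> - b \<in> \<Phi>\<^sub>+ \<longleftrightarrow> b \<notin> \<Phi>\<^sub>+"
  using pos_or_neg neg_not_pos by blast

lemma pos_if_coord_pos: "b \<in> \<Phi> \<Longrightarrow> t \<in> S \<Longrightarrow> 0 < coord t b \<Longrightarrow> b \<in> \<Phi>\<^sub>+"
  using coord_nonneg[of "- b" t] neg_pos_iff[of b] by auto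

lemma coord_srefl_other:
  "t \<in> S \<Longrightarrow> u \<in> S \<Longrightarrow> u \<noteq> t \<Longrightarrow> coord u (srefl t v) = coord u v"
  unfolding reflection_def
  using linear_diff[OF linear_coord] by (simp add: coord_scaleR)

lemma coord_srefl_self:
  "t \<in> S \<Longrightarrow> coord t (srefl t v) = coord t v - 2 * (v \<bullet> \<alpha> t) / (\<alpha> t \<bullet> \<alpha> t)"
  unfolding reflection_def
  using linear_diff[OF linear_coord] by (simp add: coord_scaleR)

lemma pos_root_other_coord:
  assumes "b \<in> \<Phi>\<^sub>+" "t \<in> S" "b \<noteq> \<alpha> t"
  shows "\<exists>u\<in>S. u \<noteq> t \<and> 0 < coord u b"
proof (rule ccontr)
  assume "\<not> ?thesis"
  then have "coord u b = 0" if "u \<in> S" "u \<noteq> t" for u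
    using that coord_nonneg[OF assms(1)] by (metis less_eq_real_def)
  then have "(\<Sum>u\<in>S. coord u b *\<^sub>R \<alpha> u) = (\<Sum>u\<in>S. if u = t then coord t b *\<^sub>R \<alpha> t else 0)"
    by (intro sum.cong) auto
  then have "b = coord t b *\<^sub>R \<alpha> t"
    using coord_expansion[OF root_in_span[OF pos_root[OF assms(1)]]] assms(2) by simp
  then have "b \<in> \<Phi> \<inter> span {\<alpha> t}"
    using pos_root[OF assms(1)] by (metis IntI singletonI span_base span_scale)
  then show False
    using roots_on_line[of "\<alpha> t"] assms neg_not_pos[of "\<alpha> t"] by auto
qed

lemma srefl_pos:
  assumes "b \<in> \<Phi>\<^sub>+" "t \<in> S" "b \<noteq> \<alpha> t"
  shows "srefl t b \<in> \<Phi>\<^sub>+"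
proof -
  obtain u where "u \<in> S" "u \<noteq> t" "0 < coord u b"
    using pos_root_other_coord[OF assms] by blast
  then show ?thesis
    using assms by (intro pos_if_coord_pos[of _ u]) (simp_all add: pos_root coord_srefl_other)
qed

lemma srefl_pos_iff:
  assumes "b \<in> \<Phi>" "t \<in> S"
  shows "srefl t b \<in> \<Phi>\<^sub>+ \<longleftrightarrow> b \<in> \<Phi>\<^sub>+ \<and> b \<noteq> \<alpha> t \<or> b = - \<alpha> t"
proof (cases "b \<in> \<Phi>\<^sub>+")
  case True
  then show ?thesis
    using srefl_pos[OF True assms(2)] neg_not_pos[of "\<alpha> t"] assms(2) by auto
next
  case False
  have "srefl t b \<notin> \<Phi>\<^sub>+" if "b \<noteq> - \<alpha> t"
  proof -
    have "- b \<noteq> \<alpha> t"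
      using that by (metis minus_minus)
    then have "srefl t (- b) \<in> \<Phi>\<^sub>+"
      using False assms by (intro srefl_pos) (simp_all add: neg_pos_iff)
    then show ?thesis
      using assms by (simp add: neg_pos_iff)
  qed
  then show ?thesis
    using False assms by auto
qed

lemma srefl_permutes_pos:
  assumes "t \<in> S"
  shows "srefl t ` (\<Phi>\<^sub>+ - {\<alpha> t}) = \<Phi>\<^sub>+ - {\<alpha> t}"
proof (rule endo_inj_surj[OF _ _ inj_reflection])
  have "- \<alpha> t \<notin> \<Phi>\<^sub>+"
    using assms neg_not_pos by simp
  then show "srefl t ` (\<Phi>\<^sub>+ - {\<alpha> t}) \<subseteq> \<Phi>\<^sub>+ - {\<alpha> t}"
    using assms srefl_pos by (auto simp: reflection_eq_iff)
qed simp

lemma inner_simple_nonpos: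
  assumes "s \<in> S" "t \<in> S" "s \<noteq> t"
  shows "\<alpha> s \<bullet> \<alpha> t \<le> 0"
proof -
  have "0 \<le> coord t (srefl t (\<alpha> s))"
    using assms by (intro coord_nonneg srefl_pos) simp_all
  moreover have "0 < \<alpha> t \<bullet> \<alpha> t"
    using assms by simp
  ultimately show ?thesis
    using assms by (simp add: coord_srefl_self divide_le_0_iff)
qed

subsection \<open>Words in the simple reflections and their root sequences\<close>

definition word_act :: "'a list \<Rightarrow> 'v \<Rightarrow> 'v" where
  "word_act u v = foldr srefl u v"

lemma word_act_Nil [simp]: "word_act [] v = v"
  and word_act_Cons [simp]: "word_act (x # u) v = srefl x (word_act u v)"
  and word_act_append [simp]: "word_act (u @ w) v = word_act u (word_act w v)"
  by (simp_all add: word_act_def)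

lemma orthogonal_transformation_word_act: "orthogonal_transformation (word_act u)"
proof (induction u)
  case Nil
  then show ?case
    by (simp add: orthogonal_transformation_def word_act_def linear_id[unfolded id_def])
next
  case (Cons x u)
  have "word_act (x # u) = srefl x \<circ> word_act u"
    by auto
  then show ?case
    using Cons orthogonal_transformation_compose orthogonal_transformation_reflection by metis
qed

lemma linear_word_act: "linear (word_act u)"
  and inner_word_act [simp]: "word_act u v \<bullet> word_act u w = v \<bullet> w"
  using orthogonal_transformation_word_act by (auto simp: orthogonal_transformation_def)

lemma word_act_minus [simp]: "word_act u (- v) = - word_act u v"
  by (simp add: linear_neg linear_word_act)

lemma word_act_rev_word_act [simp]: "word_act (rev u) (word_act u v) = v"
  by (induction u) auto

lemma word_act_word_act_rev [simp]: "word_act u (word_act (rev u) v) = v"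
  using word_act_rev_word_act[of "rev u" v] by simp

lemma word_act_eq_iff: "word_act u v = w \<longleftrightarrow> v = word_act (rev u) w"
  by (metis word_act_rev_word_act word_act_word_act_rev)

lemma word_act_rev_cong: "word_act u = word_act u' \<Longrightarrow> word_act (rev u) = word_act (rev u')"
  by (metis ext word_act_eq_iff)

lemma word_act_Cons_cancel [simp]:
  "word_act (x # u) = word_act (x # u') \<longleftrightarrow> word_act u = word_act u'"
  by (simp add: fun_eq_iff reflection_eq_iff)

lemma word_act_snoc_cancel [simp]:
  "word_act (u @ [x]) = word_act (u' @ [x]) \<longleftrightarrow> word_act u = word_act u'"
  unfolding fun_eq_iff word_act_append word_act_Cons word_act_Nil by (metis reflection_reflection)

lemma rev_in_lists [simp]: "rev u \<in> lists S \<longleftrightarrow> u \<in> lists S"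
  by (simp add: in_lists_conv_set)

lemma word_act_root [simp]: "u \<in> lists S \<Longrightarrow> b \<in> \<Phi> \<Longrightarrow> word_act u b \<in> \<Phi>"
  by (induction u) auto

lemma coord_word_act_other:
  "u \<in> lists S \<Longrightarrow> t \<in> S \<Longrightarrow> t \<notin> set u \<Longrightarrow> coord t (word_act u v) = coord t v"
  by (induction u) (auto simp: coord_srefl_other)

fun root_seq :: "'a list \<Rightarrow> 'v list" where
  "root_seq [] = []"
| "root_seq (x # u) = \<alpha> x # map (srefl x) (root_seq u)"

lemma length_root_seq [simp]: "length (root_seq u) = length u"
  by (induction u) auto

lemma root_seq_append: "root_seq (u @ w) = root_seq u @ map (word_act u) (root_seq w)"
  by (induction u) auto

lemma root_seq_snoc: "root_seq (u @ [x]) = root_seq u @ [word_act u (\<alpha> x)]"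
  by (simp add: root_seq_append)

lemma nth_root_seq: "j < length u \<Longrightarrow> root_seq u ! j = word_act (take j u) (\<alpha> (u ! j))"
  by (induction u arbitrary: j) (auto simp: nth_Cons split: nat.split)

lemma in_root_seqE:
  assumes "b \<in> set (root_seq u)"
  obtains A x B where "u = A @ x # B" "b = word_act A (\<alpha> x)"
proof -
  obtain j where j: "j < length u" "b = root_seq u ! j"
    using assms by (auto simp: in_set_conv_nth)
  show thesis
    by (rule that[OF id_take_nth_drop[OF j(1)]]) (use j in \<open>simp add: nth_root_seq\<close>)
qed

definition inversions :: "'a list \<Rightarrow> 'v set" where
  "inversions u = {b \<in> \<Phi>\<^sub>+. word_act (rev u) b \<notin> \<Phi>\<^sub>+}"

lemma inversions_subset_pos: "inversions u \<subseteq> \<Phi>\<^sub>+"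
  by (auto simp: inversions_def)

lemma finite_inversions [simp]: "finite (inversions u)"
  using finite_subset[OF inversions_subset_pos finite_pos_roots] .

lemma inversions_cong: "word_act u = word_act u' \<Longrightarrow> inversions u = inversions u'"
  unfolding inversions_def by (simp add: word_act_rev_cong[of u u'])

lemma inversions_snoc_pos:
  assumes "u \<in> lists S" "x \<in> S" "word_act u (\<alpha> x) \<in> \<Phi>\<^sub>+"
  shows "inversions (u @ [x]) = insert (word_act u (\<alpha> x)) (inversions u)"
    and "word_act u (\<alpha> x) \<notin> inversions u"
proof -
  have "srefl x (word_act (rev u) b) \<notin> \<Phi>\<^sub>+ \<longleftrightarrow>
      word_act (rev u) b \<notin> \<Phi>\<^sub>+ \<or> b = word_act u (\<alpha> x)" if "b \<in> \<Phi>\<^sub>+" for b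
  proof -
    have "b \<noteq> - word_act u (\<alpha> x)"
      using that assms(3) neg_not_pos by auto
    then show ?thesis
      using that assms by (auto simp: srefl_pos_iff pos_root word_act_eq_iff)
  qed
  then show "inversions (u @ [x]) = insert (word_act u (\<alpha> x)) (inversions u)"
    unfolding inversions_def using assms(3) by auto
  show "word_act u (\<alpha> x) \<notin> inversions u"
    using assms(2) by (simp add: inversions_def)
qed

lemma inversions_snoc_neg:
  assumes "u \<in> lists S" "x \<in> S" "word_act u (\<alpha> x) \<notin> \<Phi>\<^sub>+"
  shows "inversions u = insert (- word_act u (\<alpha> x)) (inversions (u @ [x]))"
    and "- word_act u (\<alpha> x) \<notin> inversions (u @ [x])"
proof -
  let ?w = "u @ [x]"
  have "- word_act u (\<alpha> x) = word_act ?w (\<alpha> x)" and "word_act (?w @ [x]) = word_act u"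
    by (simp_all add: fun_eq_iff)
  moreover have "- word_act u (\<alpha> x) \<in> \<Phi>\<^sub>+"
    using assms by (simp add: neg_pos_iff)
  ultimately show "inversions u = insert (- word_act u (\<alpha> x)) (inversions ?w)"
    and "- word_act u (\<alpha> x) \<notin> inversions ?w"
    using inversions_snoc_pos[of ?w x] inversions_cong[of "?w @ [x]" u] assms by simp_all
qed

lemma inversions_subset_root_seq:
  "u \<in> lists S \<Longrightarrow> inversions u \<subseteq> set (root_seq u)"
proof (induction u rule: rev_induct)
  case Nil
  then show ?case
    by (simp add: inversions_def)
next
  case (snoc x u)
  then show ?case
    using inversions_snoc_pos(1)[of u x] inversions_snoc_neg(1)[of u x]
    by (cases "word_act u (\<alpha> x) \<in> \<Phi>\<^sub>+") (auto simp: root_seq_snoc)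
qed

definition reduced :: "'a list \<Rightarrow> bool" where
  "reduced u \<longleftrightarrow> u \<in> lists S \<and> set (root_seq u) \<subseteq> \<Phi>\<^sub>+"

lemma reduced_in_lists: "reduced u \<Longrightarrow> u \<in> lists S"
  by (simp add: reduced_def)

lemma reduced_Nil [simp]: "reduced []"
  by (simp add: reduced_def)

lemma reduced_snoc: "reduced (u @ [x]) \<longleftrightarrow> reduced u \<and> x \<in> S \<and> word_act u (\<alpha> x) \<in> \<Phi>\<^sub>+"
  unfolding reduced_def by (auto simp: root_seq_snoc)

lemma reduced_appendD: "reduced (u @ w) \<Longrightarrow> reduced u"
  unfolding reduced_def by (simp add: root_seq_append)

lemma root_seq_reduced:
  "reduced u \<Longrightarrow> set (root_seq u) = inversions u \<and> distinct (root_seq u)"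
proof (induction u rule: rev_induct)
  case Nil
  then show ?case
    by (simp add: inversions_def)
next
  case (snoc x u)
  then show ?case
    using inversions_snoc_pos[of u x] by (auto simp: reduced_snoc reduced_in_lists root_seq_snoc)
qed

lemma set_root_seq_reduced: "reduced u \<Longrightarrow> set (root_seq u) = inversions u"
  and distinct_root_seq: "reduced u \<Longrightarrow> distinct (root_seq u)"
  using root_seq_reduced by blast+

lemma length_reduced: "reduced u \<Longrightarrow> length u = card (inversions u)"
  using root_seq_reduced distinct_card length_root_seq by metis

lemma card_inversions_le: "u \<in> lists S \<Longrightarrow> card (inversions u) \<le> length u"
  using inversions_subset_root_seq[of u] card_mono card_length length_root_seq
  by (metis List.finite_set le_trans)

lemma reduced_if_length:
  assumes "u \<in> lists S" "length u = card (inversions u)"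
  shows "reduced u"
proof -
  have "card (set (root_seq u)) \<le> card (inversions u)"
    using assms(2) card_length[of "root_seq u"] by simp
  then have "inversions u = set (root_seq u)"
    using inversions_subset_root_seq[OF assms(1)] by (intro card_seteq) simp_all
  then show ?thesis
    using assms(1) by (auto simp: reduced_def inversions_def)
qed

lemma reduced_shortest:
  assumes "reduced u" "u' \<in> lists S" "word_act u' = word_act u"
  shows "length u \<le> length u'"
  using length_reduced[OF assms(1)] inversions_cong[OF assms(3)] card_inversions_le[OF assms(2)]
  by simp

lemma reduced_Cons_if_pos:
  assumes "reduced u" "s \<in> S" "word_act (rev u) (\<alpha> s) \<in> \<Phi>\<^sub>+"
  shows "reduced (s # u)"
proof -
  have "srefl s b \<in> \<Phi>\<^sub>+" if "b \<in> set (root_seq u)" for b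
    using that assms set_root_seq_reduced[OF assms(1)]
    by (intro srefl_pos) (auto simp: inversions_def)
  then show ?thesis
    using assms(1,2) by (auto simp: reduced_def)
qed

lemma exchange_property:
  assumes "u \<in> lists S" "- word_act u (\<alpha> x) \<in> set (root_seq u)"
  obtains w where "w \<in> lists S" "Suc (length w) = length u" "word_act w = word_act (u @ [x])"
proof -
  obtain A y B where u: "u = A @ y # B" and "- word_act u (\<alpha> x) = word_act A (\<alpha> y)"
    using in_root_seqE[OF assms(2)] .
  then have "\<alpha> y = - srefl y (word_act B (\<alpha> x))"
    by (metis word_act_append word_act_Cons word_act_minus word_act_rev_word_act)
  then have "\<alpha> y = word_act B (\<alpha> x)"
    by (metis minus_equation_iff reflection_eq_iff reflection_minus reflection_self)
  then have "srefl y (word_act B v) = word_act B (srefl x v)" for v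
    using reflection_conjugate[OF orthogonal_transformation_word_act] by metis
  then have "word_act (A @ B) = word_act (u @ [x])"
    by (simp add: u fun_eq_iff)
  then show thesis
    using that[of "A @ B"] assms(1) u by simp
qed

lemma ex_reduced: "u \<in> lists S \<Longrightarrow> \<exists>u'. reduced u' \<and> word_act u' = word_act u"
proof (induction u rule: rev_induct)
  case Nil
  then show ?case
    using reduced_Nil by blast
next
  case (snoc x u)
  then obtain u' where u': "reduced u'" "word_act u' = word_act u" and x: "x \<in> S"
    by auto
  have eq: "word_act (u' @ [x]) = word_act (u @ [x])"
    using u'(2) by simp
  show ?case
  proof (cases "word_act u' (\<alpha> x) \<in> \<Phi>\<^sub>+")
    case True
    then show ?thesis
      using u' x eq reduced_snoc by blast
  next
    case False
    note inv = inversions_snoc_neg[OF reduced_in_lists[OF u'(1)] x False]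
    then obtain w where w: "w \<in> lists S" "Suc (length w) = length u'"
      "word_act w = word_act (u' @ [x])"
      using exchange_property[of u' x] u'(1) reduced_in_lists set_root_seq_reduced by blast
    moreover have "length u' = Suc (card (inversions (u' @ [x])))"
      using length_reduced[OF u'(1)] inv by simp
    ultimately have "reduced w"
      using inversions_cong[of w "u' @ [x]"] by (intro reduced_if_length) simp_all
    then show ?thesis
      using w(3) eq by metis
  qed
qed

lemma reduced_length_le: "reduced u \<Longrightarrow> length u \<le> card \<Phi>\<^sub>+"
  by (simp add: length_reduced card_mono inversions_subset_pos)

subsection \<open>Words of the longest element\<close>

definition longest :: "'a list \<Rightarrow> bool" where
  "longest u \<longleftrightarrow> reduced u \<and> set (root_seq u) = \<Phi>\<^sub>+"

lemma longest_reduced: "longest u \<Longrightarrow> reduced u"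
  and longest_in_lists: "longest u \<Longrightarrow> u \<in> lists S"
  and set_root_seq_longest: "longest u \<Longrightarrow> set (root_seq u) = \<Phi>\<^sub>+"
  by (simp_all add: longest_def reduced_def)

lemma longest_iff_length: "longest u \<longleftrightarrow> reduced u \<and> length u = card \<Phi>\<^sub>+"
  unfolding longest_def
  by (metis card_subset_eq finite_pos_roots inversions_subset_pos length_reduced
      set_root_seq_reduced)

lemma longest_cong:
  assumes "longest u" "u' \<in> lists S" "word_act u' = word_act u" "length u' = length u"
  shows "longest u'"
proof -
  have "length u' = card (inversions u')"
    using assms length_reduced[of u] inversions_cong[of u' u] by (metis longest_iff_length)
  then show ?thesis
    using assms reduced_if_length[of u'] by (metis longest_iff_length)
qed

lemma longest_inverts: "longest u \<Longrightarrow> b \<in> \<Phi>\<^sub>+ \<Longrightarrow> word_act (rev u) b \<notin> \<Phi>\<^sub>+"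
  using root_seq_reduced[of u] unfolding longest_def inversions_def by blast

lemma word_act_pos_eq_id:
  assumes "u \<in> lists S" "\<And>b. b \<in> \<Phi>\<^sub>+ \<Longrightarrow> word_act (rev u) b \<in> \<Phi>\<^sub>+"
  shows "word_act u v = v"
proof -
  obtain u' where u': "reduced u'" "word_act u' = word_act u"
    using ex_reduced[OF assms(1)] by blast
  have "inversions u = {}"
    using assms(2) by (auto simp: inversions_def)
  then have "u' = []"
    using length_reduced[OF u'(1)] inversions_cong[OF u'(2)] by simp
  then show ?thesis
    using u'(2) by (metis word_act_Nil)
qed

lemma longest_unique:
  assumes "longest u" "longest u'"
  shows "word_act u = word_act u'"
proof
  fix v
  have S: "u \<in> lists S" "u' \<in> lists S"
    using assms by (simp_all add: longest_in_lists)
  have "word_act (rev (rev u @ u')) b \<in> \<Phi>\<^sub>+" if "b \<in> \<Phi>\<^sub>+" for b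
  proof -
    have "word_act u b \<notin> \<Phi>\<^sub>+"
      using longest_inverts[OF assms(1)] that by (metis word_act_rev_word_act)
    then have "- word_act u b \<in> \<Phi>\<^sub>+"
      using S that by (simp add: neg_pos_iff pos_root)
    then have "word_act (rev u') (- word_act u b) \<notin> \<Phi>\<^sub>+"
      using longest_inverts[OF assms(2)] by blast
    then show ?thesis
      using S that by (simp add: neg_pos_iff pos_root)
  qed
  then have "word_act (rev u @ u') v = v"
    using S by (intro word_act_pos_eq_id) simp_all
  then show "word_act u v = word_act u' v"
    by (metis word_act_append word_act_word_act_rev)
qed

lemma longest_if_maximal:
  assumes "reduced u" "\<And>x. x \<in> S \<Longrightarrow> word_act u (\<alpha> x) \<notin> \<Phi>\<^sub>+"
  shows "longest u"
proof -
  have neg: "word_act u b \<notin> \<Phi>\<^sub>+" if b: "b \<in> \<Phi>\<^sub>+" for b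
  proof -
    have expansion: "word_act u b = (\<Sum>x\<in>S. coord x b *\<^sub>R word_act u (\<alpha> x))"
      by (subst coord_expansion[OF root_in_span[OF pos_root[OF b]]])
        (simp add: linear_sum linear_scale linear_word_act)
    have "coord t (word_act u b) \<le> 0" if t: "t \<in> S" for t
    proof -
      have "coord t (word_act u (\<alpha> x)) \<le> 0" if "x \<in> S" for x
        using assms that t coord_nonneg[of "- word_act u (\<alpha> x)" t]
        by (simp add: neg_pos_iff reduced_in_lists)
      then show ?thesis
        unfolding expansion coord_sum coord_scaleR
        using b by (intro sum_nonpos mult_nonneg_nonpos coord_nonneg) simp_all
    qed
    then show ?thesis
      using root_has_coord pos_root coord_nonneg by (metis order_antisym)
  qed
  have "word_act (rev u) b \<notin> \<Phi>\<^sub>+" if "b \<in> \<Phi>\<^sub>+" for b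
    using neg[of "word_act (rev u) b"] that by auto
  then show ?thesis
    using assms(1) by (auto simp: longest_def set_root_seq_reduced inversions_def)
qed

lemma ex_longest: "\<exists>u. longest u"
proof -
  obtain u where u: "reduced u" "\<And>w. reduced w \<Longrightarrow> length w \<le> length u"
    using ex_has_greatest_nat[of reduced "[]" length "Suc (card \<Phi>\<^sub>+)"] reduced_length_le
    by (auto simp: less_Suc_eq_le)
  have "word_act u (\<alpha> x) \<notin> \<Phi>\<^sub>+" if "x \<in> S" for x
    using u(2)[of "u @ [x]"] u(1) that by (auto simp: reduced_snoc)
  then show ?thesis
    using longest_if_maximal[OF u(1)] by blast
qed

lemma longest_rotate:
  assumes "longest (s # z)"
  obtains x where "x \<in> S" "longest (z @ [x])" "word_act z (\<alpha> x) = \<alpha> s"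
proof -
  have S: "s \<in> S" "z \<in> lists S"
    using longest_in_lists[OF assms] by simp_all
  have "srefl s ` set (root_seq z) = \<Phi>\<^sub>+ - {\<alpha> s}"
    using set_root_seq_longest[OF assms] distinct_root_seq[OF longest_reduced[OF assms]]
    by (simp only: root_seq.simps list.set set_map distinct.simps) blast
  then have roots_z: "set (root_seq z) = \<Phi>\<^sub>+ - {\<alpha> s}"
    using srefl_permutes_pos[OF S(1)] inj_image_eq_iff[OF inj_reflection] by metis
  then have z: "reduced z"
    using S by (auto simp: reduced_def)
  have len: "Suc (length z) = card \<Phi>\<^sub>+"
    using assms by (simp add: longest_iff_length)
  then obtain x where x: "x \<in> S" "word_act z (\<alpha> x) \<in> \<Phi>\<^sub>+"
    using longest_if_maximal[OF z] by (auto simp: longest_iff_length)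
  then have long: "longest (z @ [x])"
    using z len by (simp add: longest_iff_length reduced_snoc)
  have "word_act z (\<alpha> x) \<notin> set (root_seq z)"
    using distinct_root_seq[OF longest_reduced[OF long]] by (simp add: root_seq_snoc)
  then have "word_act z (\<alpha> x) = \<alpha> s"
    using x roots_z by blast
  then show thesis
    using that x(1) long by blast
qed

definition contains_longest :: "'a list \<Rightarrow> bool" where
  "contains_longest w \<longleftrightarrow> (\<exists>u. longest u \<and> subseq u w)"

lemma subseq_Cons_right_iff:
  "subseq u (x # w) \<longleftrightarrow> subseq u w \<or> (\<exists>u'. u = x # u' \<and> subseq u' w)"
  by (cases u) (auto intro: subseq_Cons')

lemma subseq_snoc_right_iff:
  "subseq u (w @ [x]) \<longleftrightarrow> subseq u w \<or> (\<exists>u'. u = u' @ [x] \<and> subseq u' w)"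
  by (auto simp: subseq_append_iff subseq_Cons_right_iff dest: list_emb_Nil2)

lemma contains_longest_rotate:
  assumes "longest (s # z)" "longest (z @ [x])"
  shows "contains_longest (s # w) \<longleftrightarrow> contains_longest (w @ [x])"
proof -
  have "longest (s # u) \<longleftrightarrow> longest (u @ [x])" for u
  proof
    assume u: "longest (s # u)"
    have "word_act u = word_act z"
      using longest_unique[OF u assms(1)] by simp
    then show "longest (u @ [x])"
      using u assms by (intro longest_cong[OF assms(2)])
        (auto simp: longest_iff_length dest: reduced_in_lists)
  next
    assume u: "longest (u @ [x])"
    have "word_act u = word_act z"
      using longest_unique[OF u assms(2)] by simp
    then show "longest (s # u)"
      using u assms by (intro longest_cong[OF assms(1)])
        (auto simp: longest_iff_length dest: reduced_in_lists)
  qed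
  then show ?thesis
    unfolding contains_longest_def subseq_Cons_right_iff subseq_snoc_right_iff by auto
qed

subsection \<open>Commutation classes of labelled words\<close>

inductive commutation_step :: "('a \<times> 'l) list \<Rightarrow> ('a \<times> 'l) list \<Rightarrow> bool" where
  "\<alpha> x \<bullet> \<alpha> y = 0 \<Longrightarrow>
     commutation_step (A @ (x, b) # (y, b') # B) (A @ (y, b') # (x, b) # B)"

abbreviation commutation_equiv :: "('a \<times> 'l) list \<Rightarrow> ('a \<times> 'l) list \<Rightarrow> bool" (infix \<open>\<simeq>\<close> 50)
  where "L \<simeq> M \<equiv> commutation_step\<^sup>*\<^sup>* L M"

lemma commutation_equiv_map:
  assumes "\<And>L M. commutation_step L M \<Longrightarrow> F L \<simeq> F M" and "L \<simeq> M"
  shows "F L \<simeq> F M"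
  using assms(2) by (induction rule: rtranclp_induct) (auto dest: assms(1))

lemma commutation_equiv_invariant:
  assumes "\<And>A x b y b' B. \<alpha> x \<bullet> \<alpha> y = 0 \<Longrightarrow>
      f (A @ (x, b) # (y, b') # B) = f (A @ (y, b') # (x, b) # B)"
    and "L \<simeq> M"
  shows "f L = f M"
  using assms(2)
  by (induction rule: rtranclp_induct) (auto elim!: commutation_step.cases intro: assms(1))

lemma commutation_equiv_context:
  fixes L :: "('a \<times> 'l) list"
  assumes "L \<simeq> M"
  shows "C @ L @ D \<simeq> C @ M @ D"
proof (rule commutation_equiv_map[OF _ assms])
  fix L M :: "('a \<times> 'l) list"
  assume "commutation_step L M"
  then show "C @ L @ D \<simeq> C @ M @ D"
  proof cases
    case (1 x y A b b' B)
    then show ?thesis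
      using commutation_step.intros[of x y "C @ A" b b' "B @ D"] by auto
  qed
qed

lemma commutation_equiv_append: "L \<simeq> M \<Longrightarrow> L' \<simeq> M' \<Longrightarrow> L @ L' \<simeq> M @ M'"
  using commutation_equiv_context[of L M "[]" L'] commutation_equiv_context[of L' M' M "[]"]
  by simp

lemma commutation_equiv_Cons: "L \<simeq> M \<Longrightarrow> p # L \<simeq> p # M"
  using commutation_equiv_context[of L M "[p]" "[]"] by simp

lemma commutation_equiv_relabel: "L \<simeq> M \<Longrightarrow> map (apsnd f) L \<simeq> map (apsnd f) M"
  by (erule commutation_equiv_map[rotated], erule commutation_step.cases)
    (auto intro: commutation_step.intros)

lemma commutation_equiv_filter: "L \<simeq> M \<Longrightarrow> filter Q L \<simeq> filter Q M"
  by (erule commutation_equiv_map[rotated], erule commutation_step.cases)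
    (auto intro: commutation_step.intros)

lemma commutation_equiv_set: "L \<simeq> M \<Longrightarrow> set L = set M"
  by (erule commutation_equiv_invariant[rotated]) auto

lemma commutation_equiv_word_act:
  "L \<simeq> M \<Longrightarrow> word_act (map fst L) = word_act (map fst M)"
  by (erule commutation_equiv_invariant[rotated])
    (auto simp: fun_eq_iff intro: arg_cong reflection_commute)

lemma contains_longest_swap:
  assumes "\<alpha> x \<bullet> \<alpha> y = 0" "contains_longest (v @ x # y # w)"
  shows "contains_longest (v @ y # x # w)"
proof -
  obtain u1 u2 where u: "longest (u1 @ u2)" "subseq u1 v" "subseq u2 (x # y # w)"
    using assms(2) unfolding contains_longest_def by (auto elim: subseq_appendE)
  consider "subseq u2 (y # x # w)" | u' where "u2 = x # y # u'" "subseq u' w"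
    using u(3) by (auto simp: subseq_Cons_right_iff)
  then show ?thesis
  proof cases
    case 1
    then show ?thesis
      using u unfolding contains_longest_def by (blast intro: list_emb_append_mono)
  next
    case 2
    have "longest (u1 @ y # x # u')"
      by (rule longest_cong[OF u(1)])
        (use 2 longest_in_lists[OF u(1)] reflection_commute[OF assms(1)] in
          \<open>auto simp: fun_eq_iff\<close>)
    moreover have "subseq (u1 @ y # x # u') (v @ y # x # w)"
      using 2 u(2) by (intro list_emb_append_mono) simp_all
    ultimately show ?thesis
      unfolding contains_longest_def by blast
  qed
qed

lemma commutation_equiv_contains_longest:
  "L \<simeq> M \<Longrightarrow> contains_longest (map fst L) = contains_longest (map fst M)"
  by (erule commutation_equiv_invariant[rotated])
    (auto simp: inner_commute intro: contains_longest_swap)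

lemma commutation_equiv_move_front:
  assumes "\<And>z. z \<in> fst ` set L \<Longrightarrow> \<alpha> z \<bullet> \<alpha> a = 0"
  shows "L @ (a, b) # M \<simeq> (a, b) # L @ M"
  using assms
proof (induction L)
  case (Cons p L)
  obtain z l where p_eq: "p = (z, l)"
    by fastforce
  have "p # L @ (a, b) # M \<simeq> p # (a, b) # L @ M"
    using Cons by (intro commutation_equiv_Cons) simp
  also have "commutation_step (p # (a, b) # L @ M) ((a, b) # p # L @ M)"
    using commutation_step.intros[of z a "[]" l b "L @ M"] Cons.prems unfolding p_eq by simp
  finally show ?case
    by simp
qed simp

subsection \<open>Words labelled by their root sequences\<close>

definition rooted :: "'a list \<Rightarrow> ('a \<times> 'v) list" where
  "rooted u = zip u (root_seq u)"

lemma rooted_Nil [simp]: "rooted [] = []"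
  and rooted_Cons [simp]: "rooted (x # u) = (x, \<alpha> x) # map (apsnd (srefl x)) (rooted u)"
  by (auto simp: rooted_def zip_map2)

lemma map_fst_rooted [simp]: "map fst (rooted u) = u"
  and map_snd_rooted [simp]: "map snd (rooted u) = root_seq u"
  by (simp_all add: rooted_def)

lemma rooted_append: "rooted (u @ w) = rooted u @ map (apsnd (word_act u)) (rooted w)"
proof (induction u)
  case Nil
  have "apsnd (\<lambda>v::'v. v) = (\<lambda>p::'a \<times> 'v. p)"
    by auto
  then show ?case
    by simp
next
  case (Cons x u)
  then show ?case
    by auto
qed

lemma word_act_orthogonal: "(\<And>z. z \<in> set u \<Longrightarrow> \<alpha> z \<bullet> v = 0) \<Longrightarrow> word_act u v = v"
  by (induction u) (auto simp: reflection_orthogonal inner_commute)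

lemma letters_orthogonal_if_roots_orthogonal:
  assumes "\<And>b. b \<in> set (root_seq u) \<Longrightarrow> b \<bullet> word_act u v = 0" "z \<in> set u"
  shows "\<alpha> z \<bullet> v = 0"
  using assms
proof (induction u arbitrary: z)
  case (Cons x u)
  have "b \<bullet> word_act u v = 0" if "b \<in> set (root_seq u)" for b
    using Cons.prems(1)[of "srefl x b"] that by simp
  then have orth: "\<alpha> y \<bullet> v = 0" if "y \<in> set u" for y
    using Cons.IH that by blast
  have "\<alpha> x \<bullet> srefl x (word_act u v) = 0"
    using Cons.prems(1)[of "\<alpha> x"] by simp
  then have "srefl x (\<alpha> x) \<bullet> word_act u v = 0"
    by (metis inner_reflection_reflection reflection_reflection)
  then have "\<alpha> x \<bullet> v = 0"
    using word_act_orthogonal[of u v] orth by simp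
  then show ?case
    using orth Cons.prems(2) by auto
qed simp

lemma rooted_move_front:
  assumes "\<And>z. z \<in> set A \<Longrightarrow> \<alpha> z \<bullet> \<alpha> a = 0"
  obtains L where "rooted (A @ a # B) = rooted A @ (a, \<alpha> a) # L"
    and "rooted (a # A @ B) = (a, \<alpha> a) # rooted A @ L"
proof -
  have fixes_a: "word_act A (\<alpha> a) = \<alpha> a"
    by (rule word_act_orthogonal) (rule assms)
  then have swap: "srefl a \<circ> word_act A = word_act A \<circ> srefl a"
    using reflection_conjugate[OF orthogonal_transformation_word_act, of A "\<alpha> a"] by auto
  have "map (apsnd (srefl a)) (rooted A) = rooted A"
    using assms
  proof (induction A)
    case (Cons z A)
    have "srefl a (srefl z v) = srefl z (srefl a v)" for v
      using reflection_commute[of "\<alpha> z" "\<alpha> a"] Cons.prems[of z] by simp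
    then have "map (apsnd (srefl a)) (map (apsnd (srefl z)) (rooted A)) =
        map (apsnd (srefl z)) (map (apsnd (srefl a)) (rooted A))"
      by auto
    then show ?case
      using Cons reflection_orthogonal[of "\<alpha> z" "\<alpha> a"] by simp
  qed simp
  then have "rooted (a # A @ B) =
      (a, \<alpha> a) # rooted A @ map (apsnd (srefl a \<circ> word_act A)) (rooted B)"
    by (simp add: rooted_append apsnd_compose)
  moreover have "rooted (A @ a # B) =
      rooted A @ (a, \<alpha> a) # map (apsnd (srefl a \<circ> word_act A)) (rooted B)"
    unfolding swap by (simp add: rooted_append apsnd_compose fixes_a)
  ultimately show thesis
    using that by blast
qed

lemma rooted_simple_to_front:
  assumes "y \<in> S" "u \<in> lists S" "\<alpha> y \<in> set (root_seq u)" "distinct (root_seq u)"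
    and sorted: "sorted_wrt R (root_seq u)"
    and orthogonal: "\<And>b. b \<in> set (root_seq u) \<Longrightarrow> b \<noteq> \<alpha> y \<Longrightarrow> R b (\<alpha> y) \<Longrightarrow> b \<bullet> \<alpha> y = 0"
  obtains w where "w \<in> lists S" "rooted u \<simeq> rooted (y # w)"
    and "sorted_wrt R (map (srefl y) (root_seq w))" "distinct (root_seq (y # w))"
proof -
  obtain A a B where u: "u = A @ a # B" and a: "\<alpha> y = word_act A (\<alpha> a)"
    using in_root_seqE[OF assms(3)] .
  have "b \<bullet> word_act A (\<alpha> a) = 0" if "b \<in> set (root_seq A)" for b
    using that sorted assms(4) orthogonal[of b] unfolding a[symmetric] u root_seq_append
    by (auto simp: sorted_wrt_append a[symmetric])
  then have orth: "\<alpha> z \<bullet> \<alpha> a = 0" if "z \<in> set A" for z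
    using letters_orthogonal_if_roots_orthogonal that by blast
  have "\<alpha> y = \<alpha> a"
    unfolding a by (rule word_act_orthogonal) (rule orth)
  then have a_eq: "a = y"
    using assms(1,2) u by simp
  obtain L where L: "rooted u = rooted A @ (y, \<alpha> y) # L"
      "rooted (y # A @ B) = (y, \<alpha> y) # rooted A @ L"
    using rooted_move_front[OF orth, of A B] unfolding u a_eq by blast
  have roots: "root_seq u = root_seq A @ \<alpha> y # map snd L"
      "root_seq (y # A @ B) = \<alpha> y # root_seq A @ map snd L"
    using L by (simp_all flip: map_snd_rooted)
  show thesis
  proof
    show "A @ B \<in> lists S"
      using assms(2) u by simp
    show "rooted u \<simeq> rooted (y # A @ B)"
      unfolding L using orth a_eq
      by (intro commutation_equiv_move_front) (simp flip: list.set_map)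
    show "sorted_wrt R (map (srefl y) (root_seq (A @ B)))"
      using sorted roots by (simp add: sorted_wrt_append)
    show "distinct (root_seq (y # A @ B))"
      using assms(4) unfolding roots by auto
  qed
qed

lemma rooted_commutation_equiv:
  assumes "u \<in> lists S" "w \<in> lists S"
    and "distinct (root_seq u)" "distinct (root_seq w)" "set (root_seq u) = set (root_seq w)"
    and "sorted_wrt R (root_seq u)" "sorted_wrt R (root_seq w)"
    and "\<And>b e. R b e \<Longrightarrow> R e b \<Longrightarrow> b \<bullet> e = 0"
  shows "rooted u \<simeq> rooted w"
  using assms
proof (induction w arbitrary: u R)
  case Nil
  then show ?case
    by (cases u) auto
next
  case (Cons y w)
  have "b \<bullet> \<alpha> y = 0" if "b \<in> set (root_seq u)" "b \<noteq> \<alpha> y" "R b (\<alpha> y)" for b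
  proof -
    have "R (\<alpha> y) b"
      using that Cons.prems(5,7) by auto
    then show ?thesis
      using that(3) Cons.prems(8) by blast
  qed
  then obtain u' where u': "u' \<in> lists S" "rooted u \<simeq> rooted (y # u')"
      "sorted_wrt R (map (srefl y) (root_seq u'))" "distinct (root_seq (y # u'))"
    using rooted_simple_to_front[of y u R] Cons.prems by auto
  have "set (root_seq (y # u')) = set (root_seq (y # w))"
    using commutation_equiv_set[OF u'(2)] Cons.prems(5) by (metis list.set_map map_snd_rooted)
  then have "srefl y ` set (root_seq u') = srefl y ` set (root_seq w)"
    using u'(4) Cons.prems(4) by (simp add: insert_ident)
  then have "set (root_seq u') = set (root_seq w)"
    by (simp add: inj_image_eq_iff inj_reflection)
  moreover have "b \<bullet> e = 0" if "R (srefl y b) (srefl y e)" "R (srefl y e) (srefl y b)" for b e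
    using Cons.prems(8)[OF that] by simp
  ultimately have "rooted u' \<simeq> rooted w"
    using Cons.prems(2,4,7) u' by (intro Cons.IH[of u' "\<lambda>b e. R (srefl y b) (srefl y e)"])
      (simp_all add: sorted_wrt_map distinct_map)
  then have "rooted (y # u') \<simeq> rooted (y # w)"
    by (simp add: commutation_equiv_Cons commutation_equiv_relabel)
  then show ?case
    using u'(2) by simp
qed

subsection \<open>Coxeter words\<close>

definition coxeter_word :: "'a list \<Rightarrow> bool" where
  "coxeter_word d \<longleftrightarrow> distinct d \<and> set d = S"

lemma coxeter_word_in_lists: "coxeter_word d \<Longrightarrow> d \<in> lists S"
  by (auto simp: coxeter_word_def)

lemma coxeter_word_rotate: "coxeter_word (s # d) \<longleftrightarrow> coxeter_word (d @ [s])"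
  by (auto simp: coxeter_word_def)

lemma orthogonal_if_word_act_fixed:
  assumes "u \<in> lists S" "distinct u" "word_act u v = v" "y \<in> set u"
  shows "v \<bullet> \<alpha> y = 0"
  using assms
proof (induction u rule: list.induct)
  case (Cons x u)
  have x: "x \<in> S" "u \<in> lists S" "x \<notin> set u"
    using Cons.prems by simp_all
  have act: "word_act u v = srefl x v"
    using Cons.prems(3) by (simp add: reflection_eq_iff)
  then have "coord x (srefl x v) = coord x v"
    using coord_word_act_other[of u x v] x by simp
  then have orth: "v \<bullet> \<alpha> x = 0"
    using x(1) by (simp add: coord_srefl_self)
  then have "word_act u v = v"
    unfolding act by (rule reflection_orthogonal)
  then show ?case
    using Cons orth by auto
qed simp

text \<open>A letter left of \<open>s\<close> that is not orthogonal to \<open>\<alpha>\<^sub>s\<close> would leave a positive coordinate in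
  the image of \<open>\<alpha>\<^sub>s\<close>.\<close>

lemma initial_letter_orthogonal:
  assumes "A @ s # B \<in> lists S" "distinct (A @ s # B)"
    and "word_act (rev (A @ s # B)) (\<alpha> s) \<notin> \<Phi>\<^sub>+" "y \<in> set A"
  shows "\<alpha> y \<bullet> \<alpha> s = 0"
proof -
  have S: "A \<in> lists S" "B \<in> lists S" "s \<in> S" and s: "s \<notin> set A"
    using assms by auto
  let ?v = "word_act (rev A) (\<alpha> s)"
  let ?w = "word_act (rev B) (srefl s ?v)"
  have v: "?v \<in> \<Phi>\<^sub>+"
    using S s by (intro pos_if_coord_pos[of _ s]) (simp_all add: coord_word_act_other)
  have "- ?w \<in> \<Phi>\<^sub>+"
    using S v assms(3) by (simp add: neg_pos_iff)
  moreover have "coord u ?w = coord u ?v" if "u \<in> set A" for u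
  proof -
    have "u \<in> S" "u \<noteq> s" "u \<notin> set B"
      using that S(1) assms(2) by auto
    then show ?thesis
      using S by (simp add: coord_word_act_other coord_srefl_other)
  qed
  ultimately have "coord u ?v \<le> 0" if "u \<in> set A" for u
    using that S(1) coord_nonneg[of "- ?w" u] by (auto simp: in_lists_conv_set)
  then have "coord u ?v \<le> 0" if "u \<in> S" "u \<noteq> s" for u
    using that S by (cases "u \<in> set A") (simp_all add: coord_word_act_other)
  then have "?v = \<alpha> s"
    using pos_root_other_coord[OF v S(3)] by force
  then show ?thesis
    using orthogonal_if_word_act_fixed[of "rev A" "\<alpha> s" y] S assms(2,4)
    by (simp add: inner_commute)
qed

lemma initial_letter_to_front:
  assumes "u \<in> lists S" "distinct u" "s \<in> set u" "word_act (rev u) (\<alpha> s) \<notin> \<Phi>\<^sub>+"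
  obtains w where "distinct (s # w)" "set (s # w) = set u" "word_act (s # w) = word_act u"
    and "map (\<lambda>x. (x, h x)) u \<simeq> map (\<lambda>x. (x, h x)) (s # w)"
proof -
  obtain A B where u: "u = A @ s # B"
    using split_list[OF assms(3)] by blast
  have "\<alpha> y \<bullet> \<alpha> s = 0" if "y \<in> set A" for y
    using initial_letter_orthogonal[of A s B y] assms that unfolding u by blast
  then have front: "map (\<lambda>x. (x, h x)) u \<simeq> map (\<lambda>x. (x, h x)) (s # A @ B)"
    using commutation_equiv_move_front[of "map (\<lambda>x. (x, h x)) A" s "h s"] by (force simp: u)
  show thesis
  proof
    show "distinct (s # A @ B)" "set (s # A @ B) = set u"
      using assms(2) by (auto simp: u)
    show "word_act (s # A @ B) = word_act u"
      using commutation_equiv_word_act[OF front] by (simp add: comp_def)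
  qed (rule front)
qed

lemma coxeter_word_initial_letter:
  assumes "coxeter_word u" "s \<in> S" "word_act (rev u) (\<alpha> s) \<notin> \<Phi>\<^sub>+"
  obtains d where "coxeter_word (s # d)" "word_act (s # d) = word_act u"
  using initial_letter_to_front[OF coxeter_word_in_lists[OF assms(1)] _ _ assms(3), of "\<lambda>_. ()"] assms
  unfolding coxeter_word_def by metis

lemma coxeter_words_commutation_equiv:
  assumes "d \<in> lists S" "distinct d" "distinct d'" "set d' = set d" "word_act d' = word_act d"
  shows "map (\<lambda>x. (x, h x)) d' \<simeq> map (\<lambda>x. (x, h x)) d"
  using assms
proof (induction d arbitrary: d' rule: list.induct)
  case (Cons s d)
  have S: "s \<in> S" "d \<in> lists S" "d' \<in> lists S"
    using Cons.prems by auto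
  have act: "word_act (rev d') (\<alpha> s) = - word_act (rev d) (\<alpha> s)"
    using word_act_rev_cong[OF Cons.prems(5)] by simp
  have "coord s (word_act (rev d') (\<alpha> s)) = - 1"
    unfolding act using Cons.prems(2) S by (simp add: coord_word_act_other)
  then have "word_act (rev d') (\<alpha> s) \<notin> \<Phi>\<^sub>+"
    using coord_nonneg[OF _ S(1)] by fastforce
  then obtain w where w: "distinct (s # w)" "set (s # w) = set d'" "word_act (s # w) = word_act d'"
    and front: "map (\<lambda>x. (x, h x)) d' \<simeq> map (\<lambda>x. (x, h x)) (s # w)"
    using initial_letter_to_front[of d' s h] S(3) Cons.prems(3,4) by auto
  have "word_act w = word_act d"
    using w(3) Cons.prems(5) by (metis word_act_Cons_cancel)
  moreover have "set w = set d"
    using w(1,2) Cons.prems(2,4) by (simp add: insert_ident)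
  ultimately have "map (\<lambda>x. (x, h x)) w \<simeq> map (\<lambda>x. (x, h x)) d"
    using Cons.prems(2) S(2) w(1) by (intro Cons.IH) simp_all
  then have "map (\<lambda>x. (x, h x)) (s # w) \<simeq> map (\<lambda>x. (x, h x)) (s # d)"
    by (simp add: commutation_equiv_Cons)
  with front show ?case
    by (rule rtranclp_trans)
qed simp

lemma distinct_word_letters:
  assumes "d \<in> lists S" "distinct d" "u \<in> lists S" "word_act u = word_act d"
  shows "set d \<subseteq> set u"
proof (rule subsetI, rule ccontr)
  fix t
  assume t: "t \<in> set d" "t \<notin> set u"
  then obtain A B where d: "d = A @ t # B"
    by (meson split_list)
  let ?v = "word_act (rev B) (\<alpha> t)"
  have "t \<in> S"
    using assms(1) d by simp
  then have "coord t (word_act u ?v) = 1" "coord t (word_act d ?v) = - 1"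
    using assms(1-3) t(2) by (simp_all add: d coord_word_act_other)
  then show False
    using assms(4) by simp
qed

lemma reduced_distinct_word:
  assumes "d \<in> lists S" "distinct d" "reduced u" "word_act u = word_act d"
  shows "distinct u \<and> set u = set d"
proof -
  have sub: "set d \<subseteq> set u"
    using distinct_word_letters assms reduced_in_lists by blast
  have len: "card (set u) \<le> length u" "length u \<le> card (set d)"
    using reduced_shortest[of u d] assms by (simp_all add: card_length distinct_card)
  then have "set u = set d"
    using sub by (intro card_seteq[symmetric]) simp_all
  then show ?thesis
    using len by (intro conjI card_distinct) simp_all
qed

subsection \<open>The skew-symmetric form of a Coxeter word\<close>

definition component :: "'a list \<Rightarrow> 'v \<Rightarrow> 'v" where
  "component d v = (\<Sum>t\<leftarrow>d. coord t v *\<^sub>R \<alpha> t)"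

lemma component_Nil [simp]: "component [] v = 0"
  and component_Cons [simp]: "component (t # d) v = coord t v *\<^sub>R \<alpha> t + component d v"
  and component_append [simp]: "component (d @ e) v = component d v + component e v"
  by (simp_all add: component_def)

lemma component_minus [simp]: "component d (- v) = - component d v"
  by (induction d) simp_all

lemma component_srefl:
  "s \<in> S \<Longrightarrow> d \<in> lists S \<Longrightarrow> s \<notin> set d \<Longrightarrow> component d (srefl s v) = component d v"
  by (induction d) (auto simp: coord_srefl_other)

lemma component_eq_0: "(\<And>t. t \<in> set d \<Longrightarrow> coord t v = 0) \<Longrightarrow> component d v = 0"
  by (induction d) simp_all

lemma component_expansion:
  assumes "coxeter_word (s # d)" "v \<in> span (\<alpha> ` S)"
  shows "v = coord s v *\<^sub>R \<alpha> s + component d v"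
proof -
  have "v = (\<Sum>t\<in>S. coord t v *\<^sub>R \<alpha> t)"
    using assms(2) by (rule coord_expansion)
  also have "\<dots> = coord s v *\<^sub>R \<alpha> s + component d v"
    using assms(1) by (auto simp: coxeter_word_def component_def sum_list_distinct_conv_sum_set)
  finally show ?thesis .
qed

primrec omega :: "'a list \<Rightarrow> 'v \<Rightarrow> 'v \<Rightarrow> real" where
  "omega [] x y = 0"
| "omega (s # d) x y =
     omega d x y + coord s y * (\<alpha> s \<bullet> component d x) - coord s x * (\<alpha> s \<bullet> component d y)"

lemma omega_snoc:
  "omega (d @ [s]) x y =
     omega d x y + coord s x * (\<alpha> s \<bullet> component d y) - coord s y * (\<alpha> s \<bullet> component d x)"
  by (induction d) (simp_all add: inner_add_right algebra_simps inner_commute)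

lemma omega_swap: "omega d y x = - omega d x y"
  by (induction d) simp_all

lemma omega_minus [simp]: "omega d (- x) y = - omega d x y"
  by (induction d) simp_all

lemma omega_srefl:
  "s \<in> S \<Longrightarrow> d \<in> lists S \<Longrightarrow> s \<notin> set d \<Longrightarrow> omega d (srefl s x) (srefl s y) = omega d x y"
  by (induction d) (auto simp: coord_srefl_other component_srefl)

lemma omega_eq_0: "(\<And>t. t \<in> set d \<Longrightarrow> coord t x = 0) \<Longrightarrow> omega d x y = 0"
  by (induction d) (simp_all add: component_eq_0)

lemma commutation_equiv_omega: "L \<simeq> M \<Longrightarrow> omega (map fst L) = omega (map fst M)"
proof (erule commutation_equiv_invariant[rotated], intro ext)
  fix A B :: "('a \<times> 'l) list" and s t b b' x y
  assume "\<alpha> s \<bullet> \<alpha> t = 0"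
  then show "omega (map fst (A @ (s, b) # (t, b') # B)) x y =
      omega (map fst (A @ (t, b') # (s, b) # B)) x y"
    by (induction A) (simp_all add: inner_add_right inner_commute algebra_simps)
qed

lemma omega_rotate:
  assumes d: "coxeter_word (s # d)" and "x \<in> span (\<alpha> ` S)" "y \<in> span (\<alpha> ` S)"
  shows "omega (d @ [s]) (srefl s x) (srefl s y) = omega (s # d) x y"
proof -
  have s: "s \<in> S" "d \<in> lists S" "s \<notin> set d" and norm: "\<alpha> s \<bullet> \<alpha> s \<noteq> 0"
    using d simple_nonzero[of s] by (auto simp: coxeter_word_def)
  have reflected: "coord s (srefl s v) = - coord s v - 2 * (\<alpha> s \<bullet> component d v) / (\<alpha> s \<bullet> \<alpha> s)"
    if "v \<in> span (\<alpha> ` S)" for v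
  proof -
    have "v \<bullet> \<alpha> s = coord s v * (\<alpha> s \<bullet> \<alpha> s) + \<alpha> s \<bullet> component d v"
      by (subst component_expansion[OF d that]) (simp add: inner_add_right inner_commute)
    then show ?thesis
      using norm s(1) by (simp add: coord_srefl_self field_simps)
  qed
  show ?thesis
    using s by (simp add: omega_snoc omega_srefl component_srefl reflected[OF assms(2)]
        reflected[OF assms(3)] algebra_simps)
qed

definition precedes :: "'a list \<Rightarrow> 'v \<Rightarrow> 'v \<Rightarrow> bool" where
  "precedes d x y \<longleftrightarrow> 0 \<le> omega d x y \<and> (omega d x y = 0 \<longrightarrow> x \<bullet> y = 0)"

lemma precedes_antisym: "precedes d x y \<Longrightarrow> precedes d y x \<Longrightarrow> x \<bullet> y = 0"
  using omega_swap[of d x y] by (simp add: precedes_def)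

lemma precedes_minus [simp]: "precedes d (- x) y \<longleftrightarrow> precedes d y x"
  using omega_swap[of d x y] by (simp add: precedes_def inner_commute)

lemma precedes_rotate:
  assumes "coxeter_word (s # d)" "x \<in> \<Phi>" "y \<in> \<Phi>"
  shows "precedes (d @ [s]) (srefl s x) (srefl s y) \<longleftrightarrow> precedes (s # d) x y"
  using omega_rotate[OF assms(1)] assms(2,3) by (simp add: precedes_def root_in_span)

lemma simple_precedes:
  assumes d: "coxeter_word (s # d)" and y: "y \<in> \<Phi>\<^sub>+" "y \<noteq> \<alpha> s"
  shows "precedes (s # d) (\<alpha> s) y"
proof -
  have s: "s \<in> S" "d \<in> lists S" "s \<notin> set d" and norm: "\<alpha> s \<bullet> \<alpha> s \<noteq> 0"
    using d simple_nonzero[of s] by (auto simp: coxeter_word_def)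
  have coord_d: "coord t (\<alpha> s) = 0" if "t \<in> set d" for t
    using s that by auto
  have omega_eq: "omega (s # d) (\<alpha> s) y = - (\<alpha> s \<bullet> component d y)"
    using s(1) coord_d by (simp add: omega_eq_0 component_eq_0)
  have y_eq: "y = coord s y *\<^sub>R \<alpha> s + component d y"
    using component_expansion[OF d root_in_span[OF pos_root[OF y(1)]]] .
  have "\<alpha> s \<bullet> component d y = (\<Sum>t\<leftarrow>d. coord t y * (\<alpha> s \<bullet> \<alpha> t))"
    by (induction d) (simp_all add: inner_add_right)
  also have "\<dots> \<le> 0"
    using s y(1)
    by (intro sum_list_nonpos) (auto intro!: mult_nonneg_nonpos coord_nonneg inner_simple_nonpos)
  finally have "0 \<le> omega (s # d) (\<alpha> s) y"
    unfolding omega_eq by simp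
  moreover have "\<alpha> s \<bullet> y = 0" if "\<alpha> s \<bullet> component d y = 0"
  proof -
    have inner_eq: "y \<bullet> \<alpha> s = coord s y * (\<alpha> s \<bullet> \<alpha> s)"
      by (subst y_eq) (simp add: inner_add_right inner_commute that)
    then have "coord s (srefl s y) = - coord s y"
      using s(1) norm by (simp add: coord_srefl_self)
    then have "coord s y = 0"
      using coord_nonneg[OF srefl_pos[OF y(1) s(1) y(2)] s(1)] coord_nonneg[OF y(1) s(1)] by simp
    then show ?thesis
      using inner_eq by (simp add: inner_commute)
  qed
  ultimately show ?thesis
    unfolding precedes_def omega_eq by simp
qed

lemma precedes_simple:
  assumes d: "coxeter_word (s # d)" and y: "y \<in> \<Phi>\<^sub>+" "y \<noteq> \<alpha> s"
  shows "precedes (d @ [s]) y (\<alpha> s)"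
proof -
  have s: "s \<in> S"
    using d by (auto simp: coxeter_word_def)
  then have "srefl s y \<in> \<Phi>\<^sub>+ - {\<alpha> s}"
    using srefl_permutes_pos[OF s] y by blast
  then have "precedes (s # d) (\<alpha> s) (srefl s y)"
    using simple_precedes[OF d] by blast
  then have "precedes (d @ [s]) (srefl s (\<alpha> s)) (srefl s (srefl s y))"
    using precedes_rotate[OF d, of "\<alpha> s" "srefl s y"] s y(1) by (simp add: pos_root)
  then show ?thesis
    by simp
qed

lemma sorted_root_seq_rotate:
  assumes d: "coxeter_word (s # d)" and long: "longest (s # z)" "longest (z @ [x])"
    and x: "word_act z (\<alpha> x) = \<alpha> s"
    and sorted: "sorted_wrt (precedes (s # d)) (root_seq (s # z))"
  shows "sorted_wrt (precedes (d @ [s])) (root_seq (z @ [x]))"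
proof -
  have roots: "root_seq (z @ [x]) = root_seq z @ [\<alpha> s]"
    by (simp add: root_seq_snoc x)
  then have "b \<in> \<Phi>\<^sub>+ \<and> b \<noteq> \<alpha> s" if "b \<in> set (root_seq z)" for b
    using that set_root_seq_longest[OF long(2)] distinct_root_seq[OF longest_reduced[OF long(2)]]
    by auto
  then have last: "precedes (d @ [s]) b (\<alpha> s)" if "b \<in> set (root_seq z)" for b
    using precedes_simple[OF d] that by blast
  have root: "b \<in> \<Phi>" if "b \<in> set (map (srefl s) (root_seq z))" for b
    using that set_root_seq_longest[OF long(1)] pos_root by auto
  have "sorted_wrt (precedes (s # d)) (map (srefl s) (root_seq z))"
    using sorted by simp
  then have "sorted_wrt (\<lambda>b e. precedes (d @ [s]) (srefl s b) (srefl s e))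
      (map (srefl s) (root_seq z))"
    by (rule sorted_wrt_mono_rel[rotated]) (simp only: precedes_rotate[OF d] root)
  then have "sorted_wrt (precedes (d @ [s])) (root_seq z)"
    by (simp add: sorted_wrt_map)
  then show ?thesis
    using last unfolding roots by (simp add: sorted_wrt_append)
qed

lemma longest_rooted_commutation_equiv:
  assumes "longest u" "sorted_wrt (precedes d) (root_seq u)"
    and "longest w" "sorted_wrt (precedes d) (root_seq w)"
  shows "rooted u \<simeq> rooted w"
  using assms longest_in_lists longest_reduced distinct_root_seq set_root_seq_longest
  by (intro rooted_commutation_equiv[of u w "precedes d"] precedes_antisym) auto

subsection \<open>Faces of a labelled word\<close>

definition face :: "('a \<times> 'l) list \<Rightarrow> 'l set \<Rightarrow> bool" where
  "face L B \<longleftrightarrow> B \<subseteq> snd ` set L \<and> contains_longest (map fst (filter (\<lambda>p. snd p \<notin> B) L))"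

lemma face_commutation_equiv: "L \<simeq> M \<Longrightarrow> face L B \<longleftrightarrow> face M B"
  unfolding face_def
  by (simp add: commutation_equiv_set
      commutation_equiv_contains_longest[OF commutation_equiv_filter])

lemma face_relabel:
  assumes "inj_on f A" "snd ` set L \<subseteq> A" "B \<subseteq> A"
  shows "face (map (apsnd f) L) (f ` B) \<longleftrightarrow> face L B"
proof -
  have "snd ` set (map (apsnd f) L) = f ` snd ` set L"
    by (simp add: image_image)
  moreover have "f (snd p) \<in> f ` B \<longleftrightarrow> snd p \<in> B" if "p \<in> set L" for p
    using inj_on_image_mem_iff[OF assms(1) _ assms(3)] assms(2) that by auto
  then have "filter (\<lambda>p. snd p \<notin> f ` B) (map (apsnd f) L) =
      map (apsnd f) (filter (\<lambda>p. snd p \<notin> B) L)"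
    by (simp add: filter_map comp_def cong: filter_cong)
  ultimately show ?thesis
    using assms by (simp add: face_def inj_on_image_subset_iff[OF assms(1)] comp_def)
qed

lemma face_rotate:
  assumes "\<forall>w. contains_longest (s # w) \<longleftrightarrow> contains_longest (w @ [x])"
  shows "face ((s, b) # L) B \<longleftrightarrow> face (L @ [(x, b)]) B"
  using assms by (auto simp: face_def)

end

subsection \<open>The greedy word of a Coxeter word\<close>

locale coxeter_sorting = root_basis S \<alpha> \<Phi>
  for S :: "'a set" and \<alpha> :: "'a \<Rightarrow> 'v::euclidean_space" and \<Phi> :: "'v set" +
  fixes d :: "'a list"
  assumes coxeter_word_d: "coxeter_word d" and d_nonempty: "d \<noteq> []"
begin

definition letter :: "nat \<Rightarrow> 'a" where
  "letter p = d ! (p mod length d)"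

lemma letter_in_S [simp]: "letter p \<in> S"
  using coxeter_word_d d_nonempty by (auto simp: letter_def coxeter_word_def)

lemma map_letter_in_lists [simp]: "map letter ps \<in> lists S"
  by (auto simp: in_lists_conv_set)

lemma ex_letter:
  assumes "x \<in> S"
  shows "\<exists>q\<ge>p. letter q = x"
proof -
  obtain i where i: "i < length d" "d ! i = x"
    using assms coxeter_word_d by (auto simp: coxeter_word_def in_set_conv_nth)
  have "p \<le> p * length d + i"
    using d_nonempty by (cases d) simp_all
  then show ?thesis
    using i by (intro exI[of _ "p * length d + i"]) (simp add: letter_def)
qed

definition transport :: "nat \<Rightarrow> 'v \<Rightarrow> 'v" where
  "transport p = word_act (rev (map letter [0..<p]))"

lemma transport_0 [simp]: "transport 0 v = v"
  and transport_Suc: "transport (Suc p) v = srefl (letter p) (transport p v)"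
  by (simp_all add: transport_def)

lemma transport_root [simp]: "b \<in> \<Phi> \<Longrightarrow> transport p b \<in> \<Phi>"
  and inner_transport [simp]: "transport p u \<bullet> transport p v = u \<bullet> v"
  and transport_minus [simp]: "transport p (- v) = - transport p v"
  by (simp_all add: transport_def)

lemma transport_eq_iff [simp]: "transport p u = transport p v \<longleftrightarrow> u = v"
  by (auto simp: transport_def word_act_eq_iff)

lemma ex_transport_root:
  assumes "b \<in> \<Phi>"
  obtains c where "c \<in> \<Phi>" "transport p c = b"
  using that[of "word_act (map letter [0..<p]) b"] assms by (simp add: transport_def)

lemma rotate_eq_letter_Cons:
  obtains e where "rotate p d = letter p # e" "rotate (Suc p) d = e @ [letter p]"
    "coxeter_word (letter p # e)"
proof
  have "hd (rotate p d) = letter p"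
    using d_nonempty by (simp add: hd_rotate_conv_nth letter_def)
  then show eq: "rotate p d = letter p # tl (rotate p d)"
    using d_nonempty by (metis list.collapse rotate_is_Nil_conv)
  then show "rotate (Suc p) d = tl (rotate p d) @ [letter p]"
    by (metis rotate1.simps(2) rotate_Suc)
  show "coxeter_word (letter p # tl (rotate p d))"
    using coxeter_word_d unfolding eq[symmetric] by (simp add: coxeter_word_def)
qed

lemma precedes_transport:
  assumes "x \<in> \<Phi>" "y \<in> \<Phi>"
  shows "precedes (rotate p d) (transport p x) (transport p y) \<longleftrightarrow> precedes d x y"
proof (induction p)
  case (Suc p)
  obtain e where "rotate p d = letter p # e" "rotate (Suc p) d = e @ [letter p]"
    "coxeter_word (letter p # e)"
    using rotate_eq_letter_Cons .
  then show ?case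
    using Suc precedes_rotate[of "letter p" e "transport p x" "transport p y"] assms
    by (simp add: transport_Suc)
qed simp

definition alive :: "nat \<Rightarrow> 'v \<Rightarrow> bool" where
  "alive p b \<longleftrightarrow> (\<forall>q\<le>p. transport q b \<in> \<Phi>\<^sub>+)"

lemma alive_0 [simp]: "alive 0 b \<longleftrightarrow> b \<in> \<Phi>\<^sub>+"
  by (simp add: alive_def)

lemma alive_transport: "alive p b \<Longrightarrow> transport p b \<in> \<Phi>\<^sub>+"
  and alive_pos: "alive p b \<Longrightarrow> b \<in> \<Phi>\<^sub>+"
  by (auto simp: alive_def dest: spec[of _ 0])

lemma alive_Suc: "alive (Suc p) b \<longleftrightarrow> alive p b \<and> transport p b \<noteq> \<alpha> (letter p)"
proof -
  have "transport (Suc p) b \<in> \<Phi>\<^sub>+ \<longleftrightarrow> transport p b \<noteq> \<alpha> (letter p)" if "alive p b"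
    using alive_transport[OF that] neg_not_pos[of "\<alpha> (letter p)"]
    by (auto simp: transport_Suc srefl_pos_iff pos_root)
  then show ?thesis
    by (auto simp: alive_def le_Suc_eq)
qed

lemma transported_to_letter_precedes:
  assumes "b \<in> \<Phi>" "transport p b = \<alpha> (letter p)" "alive p e" "e \<noteq> b"
  shows "precedes d b e"
proof -
  have "precedes (rotate p d) (\<alpha> (letter p)) (transport p e)"
  proof -
    obtain w where "rotate p d = letter p # w" "coxeter_word (letter p # w)"
      using rotate_eq_letter_Cons .
    moreover have "transport p e \<noteq> \<alpha> (letter p)"
      using assms(2,4) by (metis transport_eq_iff)
    ultimately show ?thesis
      using simple_precedes alive_transport[OF assms(3)] by simp
  qed
  then show ?thesis
    using precedes_transport[of b e p] assms alive_pos pos_root by auto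
qed

lemma dead_precedes_alive:
  assumes "b \<in> \<Phi>\<^sub>+" "\<not> alive p b" "alive p e"
  shows "precedes d b e"
  using assms(2,3)
proof (induction p)
  case (Suc p)
  then show ?case
    using transported_to_letter_precedes[of b p e] assms(1)
    by (cases "alive p b") (auto simp: alive_Suc pos_root)
qed (use assms(1) in simp)

text \<open>A dead root can only return to \<open>\<Phi>\<^sub>+\<close> when its negative is the initial simple root, which
  precedes all roots still alive.\<close>

lemma dead_stays_negative:
  assumes b: "b \<in> \<Phi>\<^sub>+" and "\<not> alive p b" "alive p e" and nonorthogonal: "b \<bullet> e \<noteq> 0"
  shows "transport p b \<notin> \<Phi>\<^sub>+"
  using assms(2,3)
proof (induction p)
  case (Suc p)
  have alive_e: "alive p e"
    using Suc.prems by (simp add: alive_Suc)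
  show ?case
  proof (cases "alive p b")
    case True
    then show ?thesis
      using Suc.prems neg_not_pos[of "\<alpha> (letter p)"] by (simp add: alive_Suc transport_Suc)
  next
    case False
    have "transport p (- b) \<noteq> \<alpha> (letter p)"
    proof
      assume "transport p (- b) = \<alpha> (letter p)"
      moreover have "e \<noteq> - b"
        using alive_pos[OF alive_e] neg_not_pos[OF b] by blast
      ultimately have "precedes d e b"
        using transported_to_letter_precedes[of "- b" p e] alive_e b by (simp add: pos_root)
      then show False
        using precedes_antisym dead_precedes_alive[OF b False alive_e] nonorthogonal by blast
    qed
    then have "transport p b \<noteq> - \<alpha> (letter p)"
      by auto
    then show ?thesis
      using Suc.IH[OF False alive_e] b by (simp add: transport_Suc srefl_pos_iff pos_root)
  qed
qed (use b in simp)

primrec greedy :: "nat \<Rightarrow> nat list" where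
  "greedy 0 = []"
| "greedy (Suc p) =
    (if word_act (map letter (greedy p)) (\<alpha> (letter p)) \<in> \<Phi>\<^sub>+ then greedy p @ [p] else greedy p)"

abbreviation greedy_word :: "nat \<Rightarrow> 'a list" where
  "greedy_word p \<equiv> map letter (greedy p)"

lemma reduced_greedy_word: "reduced (greedy_word p)"
  by (induction p) (simp_all add: reduced_snoc)

lemma rejected_letter_orthogonal:
  assumes rejected: "word_act (greedy_word p) (\<alpha> (letter p)) \<notin> \<Phi>\<^sub>+"
    and agree: "\<And>b. alive p b \<Longrightarrow> word_act (rev (greedy_word p)) b = transport p b"
    and alive_e: "alive p e"
  shows "transport p e \<bullet> \<alpha> (letter p) = 0"
proof -
  obtain b where b: "b \<in> \<Phi>" "transport p b = \<alpha> (letter p)"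
    using ex_transport_root[OF simple_root[OF letter_in_S[of p]]] .
  have "b \<bullet> e = 0"
  proof (cases "b \<in> \<Phi>\<^sub>+")
    case True
    have "\<not> alive p b"
    proof
      assume "alive p b"
      then have "b = word_act (greedy_word p) (\<alpha> (letter p))"
        using agree b(2) by (metis word_act_word_act_rev)
      then show False
        using rejected True by simp
    qed
    then show ?thesis
      using dead_stays_negative[OF True _ alive_e] b(2) by force
  next
    case False
    then have neg: "- b \<in> \<Phi>\<^sub>+"
      using b(1) by (simp add: neg_pos_iff)
    have "\<not> alive p (- b)"
      using alive_transport[of p "- b"] b(2) neg_not_pos[of "\<alpha> (letter p)"] by auto
    then have "precedes d e b"
      using dead_precedes_alive[OF neg _ alive_e] by simp
    moreover have "precedes d b e"
      using transported_to_letter_precedes[OF b alive_e] alive_pos[OF alive_e] False by blast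
    ultimately show ?thesis
      using precedes_antisym by blast
  qed
  then have "transport p b \<bullet> transport p e = 0"
    by simp
  then show ?thesis
    unfolding b(2) by (simp add: inner_commute)
qed

lemma greedy_invariant:
  "(\<forall>e. alive p e \<longrightarrow> word_act (rev (greedy_word p)) e = transport p e) \<and>
   inversions (greedy_word p) = {b \<in> \<Phi>\<^sub>+. \<not> alive p b}"
proof (induction p)
  case 0
  then show ?case
    by (simp add: inversions_def)
next
  case (Suc p)
  let ?w = "greedy_word p" and ?x = "letter p"
  let ?b = "word_act ?w (\<alpha> ?x)"
  have agree: "word_act (rev ?w) e = transport p e" if "alive p e" for e
    using Suc that by blast
  show ?case
  proof (cases "?b \<in> \<Phi>\<^sub>+")
    case True
    then have alive: "alive p ?b"
      using Suc inversions_snoc_pos(2)[of ?w ?x] by auto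
    then have "transport p e = \<alpha> ?x \<longleftrightarrow> e = ?b" for e
      using agree[OF alive] by (metis transport_eq_iff word_act_rev_word_act)
    then have "{b \<in> \<Phi>\<^sub>+. \<not> alive (Suc p) b} = insert ?b {b \<in> \<Phi>\<^sub>+. \<not> alive p b}"
      using True alive by (auto simp: alive_Suc)
    then show ?thesis
      using Suc True inversions_snoc_pos(1)[of ?w ?x] by (simp add: alive_Suc transport_Suc)
  next
    case False
    then have fixed: "transport (Suc p) e = transport p e" if "alive p e" for e
      using rejected_letter_orthogonal[OF _ agree that]
      by (simp add: transport_Suc reflection_orthogonal)
    then have "alive (Suc p) e \<longleftrightarrow> alive p e" for e
      using alive_transport by (auto simp: alive_def le_Suc_eq)
    then show ?thesis
      using Suc False fixed by simp
  qed
qed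

lemma greedy_word_sorted: "sorted_wrt (precedes d) (root_seq (greedy_word p))"
proof (induction p)
  case (Suc p)
  let ?b = "word_act (greedy_word p) (\<alpha> (letter p))"
  show ?case
  proof (cases "?b \<in> \<Phi>\<^sub>+")
    case True
    have dead: "inversions (greedy_word p) = {b \<in> \<Phi>\<^sub>+. \<not> alive p b}"
      using greedy_invariant by blast
    then have "alive p ?b"
      using True inversions_snoc_pos(2)[of "greedy_word p" "letter p"] by auto
    then have "precedes d b ?b" if "b \<in> set (root_seq (greedy_word p))" for b
      using that dead dead_precedes_alive set_root_seq_reduced[OF reduced_greedy_word] by auto
    then show ?thesis
      using Suc True by (simp add: root_seq_snoc sorted_wrt_append)
  qed (use Suc in simp)
qed simp

lemma ex_longest_greedy_word: "\<exists>p. longest (greedy_word p)"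
proof -
  obtain p where p: "\<And>q. length (greedy q) \<le> length (greedy p)"
    using ex_has_greatest_nat[of "\<lambda>_. True" 0 "\<lambda>q. length (greedy q)" "Suc (card \<Phi>\<^sub>+)"]
      reduced_length_le[OF reduced_greedy_word] by (auto simp: less_Suc_eq_le)
  have stable: "greedy q = greedy p" if "p \<le> q" for q
    using that
  proof (induction q rule: dec_induct)
    case (step q)
    then show ?case
      using p[of "Suc q"] by (simp split: if_splits)
  qed simp
  have "word_act (greedy_word p) (\<alpha> x) \<notin> \<Phi>\<^sub>+" if x: "x \<in> S" for x
  proof -
    obtain q where q: "p \<le> q" "letter q = x"
      using ex_letter[OF x] by blast
    then have "greedy (Suc q) = greedy q"
      using stable[of q] stable[of "Suc q"] by simp
    then show ?thesis
      using q stable[OF q(1)] by (simp split: if_splits)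
  qed
  then show ?thesis
    using longest_if_maximal[OF reduced_greedy_word] by blast
qed

lemma in_greedy_iff:
  "i \<in> set (greedy p) \<longleftrightarrow> i < p \<and> word_act (greedy_word i) (\<alpha> (letter i)) \<in> \<Phi>\<^sub>+"
  by (induction p) (auto simp: less_Suc_eq)

lemma greedy_strict_sorted: "sorted_wrt (<) (greedy p)"
  by (induction p) (auto simp: sorted_wrt_append in_greedy_iff)

lemma greedy_filter: "q \<le> p \<Longrightarrow> greedy q = filter (\<lambda>i. i < q) (greedy p)"
proof (induction p rule: dec_induct)
  case base
  show ?case
    by (rule filter_True[symmetric]) (simp add: in_greedy_iff)
qed simp

lemma hd_greedy: "greedy (Suc p) \<noteq> [] \<and> hd (greedy (Suc p)) = 0"
  by (induction p) auto

lemma greedy_lexord_least: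
  assumes "sorted_wrt (<) qs" "reduced (map letter qs)" "length qs = length (greedy p)"
  shows "greedy p = qs \<or> (greedy p, qs) \<in> lexord less_than"
proof (rule disjCI)
  assume "(greedy p, qs) \<notin> lexord less_than"
  show "greedy p = qs"
  proof (rule ccontr)
    assume "greedy p \<noteq> qs"
    then obtain u a b v w where "a \<noteq> b" and greedy_eq: "greedy p = u @ a # v" and qs_eq: "qs = u @ b # w"
      using same_length_different[of "greedy p" qs] assms(3) by auto
    then have "b < a"
      using \<open>(greedy p, qs) \<notin> lexord less_than\<close>
      by (metis lexord_append_left_rightI in_measure less_than_iff linorder_neqE_nat)
    have "a < p"
      using in_greedy_iff[of a p] greedy_eq by simp
    have "greedy b = filter (\<lambda>i. i < b) (u @ a # v)"
      using greedy_filter[of b p] \<open>a < p\<close> \<open>b < a\<close> greedy_eq by simp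
    also have "\<dots> = u"
      using greedy_strict_sorted[of p] assms(1) \<open>b < a\<close> unfolding greedy_eq qs_eq
      by (auto simp: sorted_wrt_append filter_empty_conv intro!: filter_True)
    finally have "greedy b = u" .
    moreover have "reduced (map letter u @ [letter b])"
      using assms(2) reduced_appendD[of "map letter u @ [letter b]"] by (simp add: qs_eq)
    ultimately have "b \<in> set (greedy p)"
      using \<open>a < p\<close> \<open>b < a\<close> by (simp add: in_greedy_iff reduced_snoc)
    then show False
      using greedy_strict_sorted[of p] assms(1) \<open>b < a\<close> unfolding greedy_eq qs_eq
      by (auto simp: sorted_wrt_append)
  qed
qed

end

subsection \<open>Reflection groups\<close>

locale reflection_group = root_basis S \<alpha> \<Phi> + group W + faithful_action W UNIV act
  for S :: "'a set" and \<alpha> :: "'a \<Rightarrow> 'v::euclidean_space" and \<Phi> :: "'v set"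
    and W :: "('a, 'b) monoid_scheme" (structure) and act :: "'a \<Rightarrow> 'v \<Rightarrow> 'v" +
  assumes generators: "S \<subseteq> carrier W" and generate_S: "generate W S = carrier W"
    and act_generator: "t \<in> S \<Longrightarrow> act t = reflection (\<alpha> t)"
begin

lemma generator_closed [simp]: "s \<in> S \<Longrightarrow> s \<in> carrier W"
  using generators by blast

lemma word_prod_Nil [simp]: "word_prod W [] = \<one>"
  and word_prod_Cons [simp]: "word_prod W (x # u) = x \<otimes> word_prod W u"
  by (simp_all add: word_prod_def)

lemma word_prod_closed [simp]: "u \<in> lists S \<Longrightarrow> word_prod W u \<in> carrier W"
  by (induction u) auto

lemma word_prod_append:
  "u \<in> lists S \<Longrightarrow> w \<in> lists S \<Longrightarrow> word_prod W (u @ w) = word_prod W u \<otimes> word_prod W w"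
  by (induction u) (auto simp: m_assoc)

lemma act_word_prod: "u \<in> lists S \<Longrightarrow> act (word_prod W u) = word_act u"
proof (induction u)
  case Nil
  then show ?case
    using id_eq_one by (auto simp: fun_eq_iff)
next
  case (Cons x u)
  then show ?case
    using composition_rule[of _ x "word_prod W u"] by (auto simp: act_generator)
qed

lemma word_prod_eq_iff:
  assumes "u \<in> lists S" "w \<in> lists S"
  shows "word_prod W u = word_prod W w \<longleftrightarrow> word_act u = word_act w"
  using assms inj_onD[OF faithful] word_prod_closed by (metis act_word_prod)

lemma generator_square: "s \<in> S \<Longrightarrow> s \<otimes> s = \<one>"
  using word_prod_eq_iff[of "[s, s]" "[]"] by (simp add: fun_eq_iff)

lemma ex_word:
  assumes "g \<in> carrier W"
  shows "\<exists>u\<in>lists S. word_prod W u = g"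
proof -
  have "g \<in> generate W S"
    using assms generate_S by simp
  then show ?thesis
  proof (induction rule: generate.induct)
    case one
    show ?case
      by (rule bexI[of _ "[]"]) simp_all
  next
    case (incl h)
    then show ?case
      by (intro bexI[of _ "[h]"]) simp_all
  next
    case (inv h)
    then have "inv h = h"
      using inv_equality[of h h] generator_square by simp
    then show ?case
      using inv by (intro bexI[of _ "[h]"]) simp_all
  next
    case (eng g h)
    then obtain u w where "u \<in> lists S" "w \<in> lists S" "word_prod W u = g" "word_prod W w = h"
      by blast
    then show ?case
      by (intro bexI[of _ "u @ w"]) (simp_all add: word_prod_append)
  qed
qed

lemma ex_reduced_word:
  assumes "g \<in> carrier W"
  obtains u where "reduced u" "word_prod W u = g"
proof -
  obtain u where u: "u \<in> lists S" "word_prod W u = g"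
    using ex_word[OF assms] by blast
  obtain u' where "reduced u'" "word_act u' = word_act u"
    using ex_reduced[OF u(1)] by blast
  then show thesis
    using that[of u'] word_prod_eq_iff[of u' u] u reduced_in_lists by simp
qed

lemma cox_length_word_prod:
  assumes "u \<in> lists S"
  shows "cox_length W S (word_prod W u) = card (inversions u)"
  unfolding cox_length_def
proof (rule Least_equality)
  obtain u' where u': "reduced u'" "word_act u' = word_act u"
    using ex_reduced[OF assms] by blast
  then have "length u' = card (inversions u)"
    using length_reduced inversions_cong by metis
  then show "\<exists>w\<in>lists S. length w = card (inversions u) \<and> word_prod W w = word_prod W u"
    using u' assms word_prod_eq_iff reduced_in_lists by blast
next
  fix k
  assume "\<exists>w\<in>lists S. length w = k \<and> word_prod W w = word_prod W u"
  then obtain w where "w \<in> lists S" "length w = k" "word_act w = word_act u"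
    using assms word_prod_eq_iff by blast
  then show "card (inversions u) \<le> k"
    using card_inversions_le[of w] inversions_cong[of w u] by simp
qed

lemma reduced_word_iff: "reduced_word W S u g \<longleftrightarrow> reduced u \<and> word_prod W u = g"
  unfolding reduced_word_def
  by (metis cox_length_word_prod length_reduced reduced_if_length reduced_in_lists)

lemma cox_length_le_card_pos_roots:
  assumes "g \<in> carrier W"
  shows "cox_length W S g \<le> card \<Phi>\<^sub>+"
  using ex_word[OF assms] cox_length_word_prod card_mono[OF finite_pos_roots inversions_subset_pos]
  by metis

lemma longest_element_eq:
  assumes "longest u"
  shows "longest_element W S = word_prod W u"
  unfolding longest_element_def
proof (rule the_equality)
  have u: "u \<in> lists S"
    using assms by (rule longest_in_lists)
  have max: "cox_length W S (word_prod W u) = card \<Phi>\<^sub>+"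
    using assms cox_length_word_prod[OF u] by (simp add: longest_iff_length flip: length_reduced)
  then show "word_prod W u \<in> carrier W \<and>
      (\<forall>h\<in>carrier W. cox_length W S h \<le> cox_length W S (word_prod W u))"
    using u cox_length_le_card_pos_roots by simp
  fix g
  assume g: "g \<in> carrier W \<and> (\<forall>h\<in>carrier W. cox_length W S h \<le> cox_length W S g)"
  then obtain w where w: "reduced w" "word_prod W w = g"
    using ex_reduced_word by blast
  have "card \<Phi>\<^sub>+ \<le> cox_length W S g"
    using g u max by (metis word_prod_closed)
  then have "card \<Phi>\<^sub>+ \<le> length w"
    using cox_length_word_prod[of w] w by (simp add: length_reduced reduced_in_lists)
  then have "longest w"
    using w(1) reduced_length_le[OF w(1)] by (simp add: longest_iff_length)
  then show "g = word_prod W u"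
    using w longest_unique[OF assms] word_prod_eq_iff[OF u] longest_in_lists by metis
qed

lemma reduced_word_longest_element_iff:
  "reduced_word W S w (longest_element W S) \<longleftrightarrow> longest w"
proof -
  obtain u where u: "longest u"
    using ex_longest by blast
  show ?thesis
  proof
    assume "longest w"
    then show "reduced_word W S w (longest_element W S)"
      using longest_element_eq[of w] by (simp add: reduced_word_iff longest_reduced)
  next
    assume "reduced_word W S w (longest_element W S)"
    then have w: "reduced w" "word_act w = word_act u"
      using longest_element_eq[OF u] word_prod_eq_iff[of w u] longest_in_lists[OF u]
      by (auto simp: reduced_word_iff reduced_in_lists)
    then have "length w = length u"
      using u inversions_cong[of w u] by (metis length_reduced longest_reduced)
    then show "longest w"
      using w longest_cong[OF u] reduced_in_lists by blast
  qed
qed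

lemma nths_Compl_labels:
  assumes "distinct (map snd L)" "X \<subseteq> {..<length L}"
  shows "nths L (- X) = filter (\<lambda>p. snd p \<notin> (\<lambda>i. snd (L ! i)) ` X) L"
proof -
  have "inj_on (\<lambda>i. snd (L ! i)) {..<length L}"
    using assms(1) by (auto simp: inj_on_def distinct_conv_nth)
  then have "i \<in> - X \<longleftrightarrow> snd (L ! i) \<notin> (\<lambda>i. snd (L ! i)) ` X" if "i < length L" for i
    using inj_on_image_mem_iff[OF _ _ assms(2)] that by auto
  then have "nths L (- X) = nths L {i. i < length L \<and> snd (L ! i) \<notin> (\<lambda>i. snd (L ! i)) ` X}"
    unfolding nths_def
    by (intro arg_cong[where f = "map fst"] filter_cong) (auto simp: set_zip)
  then show ?thesis
    by (simp only: filter_eq_nths)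
qed

lemma subword_complex_iff_face:
  assumes "distinct (map snd L)" "X \<subseteq> {..<length L}"
  shows "X \<in> subword_complex W S (map fst L) (longest_element W S) \<longleftrightarrow>
    face L ((\<lambda>i. snd (L ! i)) ` X)"
proof -
  have "(\<lambda>i. snd (L ! i)) ` X \<subseteq> snd ` set L"
    using assms(2) by auto
  then show ?thesis
    using assms(2) nths_Compl_labels[OF assms]
    by (simp add: subword_complex_def face_def contains_longest_def nths_map
        reduced_word_longest_element_iff)
qed

definition labelled_word :: "'a list \<Rightarrow> ('a \<times> 'v) list" where
  "labelled_word d = map (\<lambda>x. (x, - \<alpha> x)) d @ rooted (sorting_word W S d)"

lemma coxeter_word_reduced_word:
  assumes "coxeter_element W S c" "reduced_word W S u c"
  shows "coxeter_word u"
proof -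
  obtain d where d: "distinct d" "set d = S" "word_prod W d = c"
    using assms(1) unfolding coxeter_element_def by blast
  have u: "reduced u" "word_prod W u = c"
    using assms(2) by (simp_all add: reduced_word_iff)
  have "d \<in> lists S"
    using d(2) by auto
  then have "distinct u \<and> set u = set d"
    using reduced_distinct_word[of d u] word_prod_eq_iff[of u d] d u reduced_in_lists by simp
  then show ?thesis
    using d(2) by (simp add: coxeter_word_def)
qed

lemma initial_letter_reduced_word:
  assumes "reduced u" "initial_letter W S s (word_prod W u)"
  shows "word_act (rev u) (\<alpha> s) \<notin> \<Phi>\<^sub>+"
proof
  assume "word_act (rev u) (\<alpha> s) \<in> \<Phi>\<^sub>+"
  moreover have s: "s \<in> S"
    using assms(2) by (simp add: initial_letter_def)
  ultimately have "reduced (s # u)"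
    using reduced_Cons_if_pos[OF assms(1)] by blast
  then show False
    using assms cox_length_word_prod[of u] cox_length_word_prod[of "s # u"] s
      length_reduced[of u] length_reduced[of "s # u"] reduced_in_lists
    by (simp add: initial_letter_def)
qed

lemma coxeter_element_initial_letter:
  assumes "coxeter_element W S c" "initial_letter W S s c"
  obtains d where "coxeter_word (s # d)" "word_prod W (s # d) = c"
proof -
  have s: "s \<in> S"
    using assms(2) by (simp add: initial_letter_def)
  have "c \<in> carrier W"
    using assms(1) unfolding coxeter_element_def by (metis in_listsI word_prod_closed)
  then obtain u where u: "reduced u" "word_prod W u = c"
    using ex_reduced_word by blast
  then have "coxeter_word u" "word_act (rev u) (\<alpha> s) \<notin> \<Phi>\<^sub>+"
    using coxeter_word_reduced_word[OF assms(1)] initial_letter_reduced_word[of u s] assms(2)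
    by (simp_all add: reduced_word_iff)
  then obtain d where d: "coxeter_word (s # d)" "word_act (s # d) = word_act u"
    using coxeter_word_initial_letter s by blast
  then have "word_prod W (s # d) = c"
    using u word_prod_eq_iff coxeter_word_in_lists reduced_in_lists by blast
  then show thesis
    using that d(1) by blast
qed

lemma word_prod_rotate:
  assumes "s # d \<in> lists S"
  shows "word_prod W (d @ [s]) = s \<otimes> word_prod W (s # d) \<otimes> s"
proof -
  have "s \<otimes> word_prod W (s # d) = word_prod W d"
    using assms by (simp add: m_assoc[symmetric] generator_square)
  then show ?thesis
    using assms by (simp add: word_prod_append)
qed

subsection \<open>The involution on almost positive roots\<close>

lemma root_sigma_pos: "s \<in> S \<Longrightarrow> b \<in> \<Phi>\<^sub>+ \<Longrightarrow> root_sigma S act \<alpha> s b = srefl s b"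
  unfolding root_sigma_def using act_generator neg_not_pos[of b] by auto

lemma root_sigma_neg_simple:
  "s \<in> S \<Longrightarrow> t \<in> S \<Longrightarrow> root_sigma S act \<alpha> s (- \<alpha> t) = (if t = s then \<alpha> s else - \<alpha> t)"
  unfolding root_sigma_def by (auto simp: act_generator)

lemma root_sigma_involution:
  assumes "s \<in> S" "b \<in> almost_pos_roots S \<alpha> \<Phi>"
  shows "root_sigma S act \<alpha> s (root_sigma S act \<alpha> s b) = b"
proof -
  consider "b = \<alpha> s" | "b \<in> \<Phi>\<^sub>+" "b \<noteq> \<alpha> s" | t where "t \<in> S" "b = - \<alpha> t"
    using assms(2) unfolding almost_pos_roots_def by auto
  then show ?thesis
    by cases (use assms(1) srefl_pos in \<open>simp_all add: root_sigma_pos root_sigma_neg_simple\<close>)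
qed

lemma inj_on_root_sigma: "s \<in> S \<Longrightarrow> inj_on (root_sigma S act \<alpha> s) (almost_pos_roots S \<alpha> \<Phi>)"
  by (rule inj_on_inverseI) (rule root_sigma_involution)

end

subsection \<open>The complex of a Coxeter word\<close>

locale coxeter_complex = reflection_group S \<alpha> \<Phi> W act + coxeter_sorting S \<alpha> \<Phi> d
  for S :: "'a set" and \<alpha> :: "'a \<Rightarrow> 'v::euclidean_space" and \<Phi> :: "'v set"
    and W :: "('a, 'b) monoid_scheme" (structure) and act :: "'a \<Rightarrow> 'v \<Rightarrow> 'v"
    and d :: "'a list"
begin

lemma longest_positions_iff:
  "longest_positions W S d ps \<longleftrightarrow> sorted_wrt (<) ps \<and> longest (map letter ps)"
  by (simp add: longest_positions_def reduced_word_longest_element_iff letter_def[abs_def])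

lemma sorting_positions_eq_greedy:
  assumes "longest (greedy_word p)"
  shows "sorting_positions W S d = greedy p"
  unfolding sorting_positions_def
proof (rule the_equality)
  have greedy: "longest_positions W S d (greedy p)"
    using assms greedy_strict_sorted by (simp add: longest_positions_iff)
  have least: "greedy p = qs \<or> (greedy p, qs) \<in> lexord less_than"
    if "longest_positions W S d qs" for qs
    using that assms
    by (intro greedy_lexord_least) (simp_all add: longest_positions_iff longest_iff_length)
  show "longest_positions W S d (greedy p) \<and>
      (\<forall>qs. longest_positions W S d qs \<longrightarrow> greedy p = qs \<or> (greedy p, qs) \<in> lexord less_than)"
    using greedy least by blast
  fix ps
  assume "longest_positions W S d ps \<and>
      (\<forall>qs. longest_positions W S d qs \<longrightarrow> ps = qs \<or> (ps, qs) \<in> lexord less_than)"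
  then show "ps = greedy p"
    using greedy least[of ps] lexord_asymmetric[OF asym_less_than] by blast
qed

lemma sorting_word_eq_greedy_word:
  "longest (greedy_word p) \<Longrightarrow> sorting_word W S d = greedy_word p"
  unfolding sorting_word_def by (simp add: sorting_positions_eq_greedy letter_def)

lemma longest_sorting_word: "longest (sorting_word W S d)"
  and sorting_word_sorted: "sorted_wrt (precedes d) (root_seq (sorting_word W S d))"
  using ex_longest_greedy_word greedy_word_sorted sorting_word_eq_greedy_word by metis+

lemma sorting_word_eq_Cons: "\<exists>z. sorting_word W S d = hd d # z"
proof -
  obtain p where p: "longest (greedy_word p)"
    using ex_longest_greedy_word by blast
  have "p \<noteq> 0"
  proof
    assume "p = 0"
    then have "\<Phi>\<^sub>+ = {}"
      using set_root_seq_longest[OF p] by simp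
    then show False
      using simple_pos[OF letter_in_S] by blast
  qed
  then have "greedy p \<noteq> []" "hd (greedy p) = 0"
    using hd_greedy by (metis not0_implies_Suc)+
  then have "sorting_word W S d = letter 0 # map letter (tl (greedy p))"
    using sorting_word_eq_greedy_word[OF p] by (metis list.collapse list.simps(9))
  then show ?thesis
    using d_nonempty by (simp add: letter_def hd_conv_nth)
qed

lemma distinct_labels: "distinct (map snd (labelled_word d))"
  and labels: "snd ` set (labelled_word d) = almost_pos_roots S \<alpha> \<Phi>"
proof -
  have d: "distinct d" "set d = S"
    using coxeter_word_d by (simp_all add: coxeter_word_def)
  have roots: "distinct (root_seq (sorting_word W S d))"
      "set (root_seq (sorting_word W S d)) = \<Phi>\<^sub>+"
    using longest_sorting_word by (simp_all add: distinct_root_seq longest_reduced set_root_seq_longest)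
  have neg: "- \<alpha> x \<notin> \<Phi>\<^sub>+" if "x \<in> S" for x
    using that neg_not_pos by simp
  have split: "map snd (labelled_word d) =
      map (\<lambda>x. - \<alpha> x) d @ root_seq (sorting_word W S d)"
    by (simp add: labelled_word_def comp_def)
  show "distinct (map snd (labelled_word d))"
    unfolding split using d(1) roots neg inj_on_simple unfolding d(2)[symmetric]
    by (auto simp: distinct_map inj_on_def)
  show "snd ` set (labelled_word d) = almost_pos_roots S \<alpha> \<Phi>"
    unfolding set_map[symmetric] split using d(2) roots(2) by (auto simp: almost_pos_roots_def)
qed

lemma Lr_eq_label:
  assumes "i < length (labelled_word d)"
  shows "Lr W S act \<alpha> d i = snd (labelled_word d ! i)"
proof (cases "i < length d")
  case True
  then show ?thesis
    by (simp add: Lr_def labelled_word_def nth_append)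
next
  case False
  let ?w = "sorting_word W S d" and ?j = "i - length d"
  have "?j < length ?w"
    using assms False by (simp add: labelled_word_def rooted_def)
  moreover have "take ?j ?w \<in> lists S"
    using longest_in_lists[OF longest_sorting_word] by (auto dest: in_set_takeD)
  ultimately show ?thesis
    using False by (simp add: Lr_def labelled_word_def nth_append rooted_def nth_root_seq
        act_word_prod Let_def)
qed

lemma root_subword_complex_iff_face:
  "B \<in> root_subword_complex W S act \<alpha> d \<longleftrightarrow> face (labelled_word d) B"
proof -
  let ?L = "labelled_word d"
  let ?label = "\<lambda>i. snd (?L ! i)" and ?I = "{..<length ?L}"
  have word: "d @ sorting_word W S d = map fst ?L"
    by (simp add: labelled_word_def comp_def)
  have "B \<in> root_subword_complex W S act \<alpha> d \<longleftrightarrow>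
      (\<exists>X\<subseteq>?I. B = Lr W S act \<alpha> d ` X \<and>
        X \<in> subword_complex W S (map fst ?L) (longest_element W S))"
    unfolding root_subword_complex_def word by (auto simp: subword_complex_def)
  also have "\<dots> \<longleftrightarrow> (\<exists>X\<subseteq>?I. B = ?label ` X \<and> face ?L B)"
    using subword_complex_iff_face[OF distinct_labels] Lr_eq_label
    by (intro ex_cong1 conj_cong refl) (auto simp: subset_iff cong: image_cong)
  also have "\<dots> \<longleftrightarrow> B \<subseteq> ?label ` ?I \<and> face ?L B"
    by (auto simp: subset_image_iff)
  also have "\<dots> \<longleftrightarrow> face ?L B"
    by (auto simp: face_def set_conv_nth)
  finally show ?thesis .
qed

end

context reflection_group
begin

lemma coxeter_complexI: "coxeter_word d \<Longrightarrow> d \<noteq> [] \<Longrightarrow> coxeter_complex S \<alpha> \<Phi> W act d"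
  by unfold_locales

lemma root_subword_complex_cong:
  assumes "coxeter_word d" "coxeter_word d'" "d \<noteq> []" "word_prod W d = word_prod W d'"
  shows "root_subword_complex W S act \<alpha> d = root_subword_complex W S act \<alpha> d'"
proof -
  have "d' \<noteq> []"
    using assms(1-3) by (auto simp: coxeter_word_def)
  interpret d: coxeter_complex S \<alpha> \<Phi> W act d
    using assms by (intro coxeter_complexI)
  interpret d': coxeter_complex S \<alpha> \<Phi> W act d'
    using assms \<open>d' \<noteq> []\<close> by (intro coxeter_complexI)
  have "word_act d = word_act d'"
    using assms word_prod_eq_iff coxeter_word_in_lists by blast
  then have coxeter_part: "map (\<lambda>x. (x, h x)) d \<simeq> map (\<lambda>x. (x, h x)) d'" for h :: "'a \<Rightarrow> 'v"
    using assms coxeter_word_in_lists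
    by (intro coxeter_words_commutation_equiv) (simp_all add: coxeter_word_def)
  then have "omega d = omega d'"
    using commutation_equiv_omega[OF coxeter_part] by (simp add: comp_def)
  then have "precedes d = precedes d'"
    by (simp add: precedes_def fun_eq_iff)
  then have "rooted (sorting_word W S d) \<simeq> rooted (sorting_word W S d')"
    using d.longest_sorting_word d'.longest_sorting_word d.sorting_word_sorted
      d'.sorting_word_sorted longest_rooted_commutation_equiv by simp
  then have "labelled_word d \<simeq> labelled_word d'"
    unfolding labelled_word_def using coxeter_part by (rule commutation_equiv_append[rotated])
  then show ?thesis
    using face_commutation_equiv d.root_subword_complex_iff_face d'.root_subword_complex_iff_face
    by blast
qed

lemma labelled_word_rotate:
  assumes d: "coxeter_word (s # d)"
  obtains L x where "labelled_word (s # d) = (s, - \<alpha> s) # L"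
    and "labelled_word (d @ [s]) \<simeq> map (apsnd (root_sigma S act \<alpha> s)) (L @ [(x, - \<alpha> s)])"
    and "\<forall>w. contains_longest (s # w) \<longleftrightarrow> contains_longest (w @ [x])"
proof -
  interpret c: coxeter_complex S \<alpha> \<Phi> W act "s # d"
    using d by (intro coxeter_complexI) simp_all
  interpret c': coxeter_complex S \<alpha> \<Phi> W act "d @ [s]"
    using d by (intro coxeter_complexI) (simp_all flip: coxeter_word_rotate)
  let ?neg = "map (\<lambda>x. (x, - \<alpha> x))" and ?\<sigma> = "root_sigma S act \<alpha> s"
  have s: "s \<in> S" "set d \<subseteq> S" "s \<notin> set d"
    using d by (auto simp: coxeter_word_def)
  obtain z where z: "sorting_word W S (s # d) = s # z"
    using c.sorting_word_eq_Cons by auto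
  then have long_z: "longest (s # z)" and sorted_z: "sorted_wrt (precedes (s # d)) (root_seq (s # z))"
    using c.longest_sorting_word c.sorting_word_sorted by simp_all
  obtain x where x: "longest (z @ [x])" "word_act z (\<alpha> x) = \<alpha> s"
    using longest_rotate[OF long_z] by blast
  let ?L = "?neg d @ rooted (s # z)"
  have "map (apsnd ?\<sigma>) (map (apsnd (srefl s)) (rooted z)) = rooted z"
  proof -
    have "srefl s (snd p) \<in> \<Phi>\<^sub>+" if "p \<in> set (rooted z)" for p
      using that set_root_seq_longest[OF long_z] by (auto simp flip: map_snd_rooted)
    then show ?thesis
      using s(1) unfolding map_map by (intro map_idI prod_eqI) (simp_all add: root_sigma_pos)
  qed
  moreover have "map (apsnd ?\<sigma>) (?neg d) = ?neg d"
    using s by (auto simp: root_sigma_neg_simple)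
  ultimately have rotated:
    "map (apsnd ?\<sigma>) (?L @ [(x, - \<alpha> s)]) = ?neg (d @ [s]) @ rooted (z @ [x])"
    using s(1) x(2) by (simp add: root_sigma_pos root_sigma_neg_simple rooted_append)
  have "rooted (sorting_word W S (d @ [s])) \<simeq> rooted (z @ [x])"
    using c'.longest_sorting_word c'.sorting_word_sorted x(1)
      sorted_root_seq_rotate[OF d long_z x sorted_z] by (rule longest_rooted_commutation_equiv)
  then have "labelled_word (d @ [s]) \<simeq> map (apsnd ?\<sigma>) (?L @ [(x, - \<alpha> s)])"
    unfolding rotated labelled_word_def by (intro commutation_equiv_append) simp_all
  then show thesis
    using that[of ?L x] contains_longest_rotate[OF long_z x(1)] by (simp add: labelled_word_def z)
qed

lemma root_subword_complex_rotate:
  assumes d: "coxeter_word (s # d)" and B: "B \<subseteq> almost_pos_roots S \<alpha> \<Phi>"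
  shows "B \<in> root_subword_complex W S act \<alpha> (s # d) \<longleftrightarrow>
    root_sigma S act \<alpha> s ` B \<in> root_subword_complex W S act \<alpha> (d @ [s])"
proof -
  interpret c: coxeter_complex S \<alpha> \<Phi> W act "s # d"
    using d by (intro coxeter_complexI) simp_all
  interpret c': coxeter_complex S \<alpha> \<Phi> W act "d @ [s]"
    using d by (intro coxeter_complexI) (simp_all flip: coxeter_word_rotate)
  let ?\<sigma> = "root_sigma S act \<alpha> s"
  have s: "s \<in> S"
    using d by (auto simp: coxeter_word_def)
  obtain L x where L: "labelled_word (s # d) = (s, - \<alpha> s) # L"
    "labelled_word (d @ [s]) \<simeq> map (apsnd ?\<sigma>) (L @ [(x, - \<alpha> s)])"
    "\<forall>w. contains_longest (s # w) \<longleftrightarrow> contains_longest (w @ [x])"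
    by (rule labelled_word_rotate[OF d])
  have labels: "snd ` set (L @ [(x, - \<alpha> s)]) \<subseteq> almost_pos_roots S \<alpha> \<Phi>"
    using c.labels unfolding L(1) by auto
  have "B \<in> root_subword_complex W S act \<alpha> (s # d) \<longleftrightarrow> face ((s, - \<alpha> s) # L) B"
    using c.root_subword_complex_iff_face L(1) by simp
  also have "\<dots> \<longleftrightarrow> face (L @ [(x, - \<alpha> s)]) B"
    using L(3) by (rule face_rotate)
  also have "\<dots> \<longleftrightarrow> face (map (apsnd ?\<sigma>) (L @ [(x, - \<alpha> s)])) (?\<sigma> ` B)"
    using face_relabel[OF inj_on_root_sigma[OF s] labels B] by simp
  also have "\<dots> \<longleftrightarrow> face (labelled_word (d @ [s])) (?\<sigma> ` B)"
    using face_commutation_equiv[OF L(2)] by simp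
  also have "\<dots> \<longleftrightarrow> ?\<sigma> ` B \<in> root_subword_complex W S act \<alpha> (d @ [s])"
    using c'.root_subword_complex_iff_face by simp
  finally show ?thesis .
qed

end

theorem theorem5p7:
  fixes W :: "('a, 'b) monoid_scheme"
    and S :: "'a set"
    and act :: "'a \<Rightarrow> 'v::euclidean_space \<Rightarrow> 'v"
    and \<alpha> :: "'a \<Rightarrow> 'v"
    and \<Phi> :: "'v set"
    and c c' s :: 'a
    and cw cw' :: "'a list"
    and \<beta>1 \<beta>2 :: 'v
  assumes "finite_coxeter_system W S"
    and "reflection_action W S act \<alpha> \<Phi>"
    and "coxeter_element W S c"
    and "reduced_word W S cw c"
    and "initial_letter W S s c"
    and "c' = s \<otimes>\<^bsub>W\<^esub> c \<otimes>\<^bsub>W\<^esub> s"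
    and "reduced_word W S cw' c'"
    and "\<beta>1 \<in> almost_pos_roots S \<alpha> \<Phi>"
    and "\<beta>2 \<in> almost_pos_roots S \<alpha> \<Phi>"
  shows "{\<beta>1, \<beta>2} \<in> root_subword_complex W S act \<alpha> cw \<longleftrightarrow>
         {root_sigma S act \<alpha> s \<beta>1, root_sigma S act \<alpha> s \<beta>2} \<in> root_subword_complex W S act \<alpha> cw'"
proof -
  interpret reflection_group S \<alpha> \<Phi> W act
    using assms(1,2)
    unfolding finite_coxeter_system_def coxeter_system_def reflection_action_def
    by (intro reflection_group.intro root_basis.intro reflection_group_axioms.intro) auto
  obtain d where d: "coxeter_word (s # d)" "word_prod W (s # d) = c"
    using coxeter_element_initial_letter assms(3,5) .
  have d': "coxeter_word (d @ [s])" "word_prod W (d @ [s]) = c'"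
    using d assms(6) word_prod_rotate[OF coxeter_word_in_lists[OF d(1)]]
    by (simp_all flip: coxeter_word_rotate)
  have cw: "coxeter_word cw" "word_prod W cw = c"
    using assms(3,4) coxeter_word_reduced_word by (simp_all add: reduced_word_iff)
  have "coxeter_element W S c'"
    using d' unfolding coxeter_element_def coxeter_word_def by blast
  then have cw': "coxeter_word cw'" "word_prod W cw' = c'"
    using assms(7) coxeter_word_reduced_word by (simp_all add: reduced_word_iff)
  have "{\<beta>1, \<beta>2} \<in> root_subword_complex W S act \<alpha> cw \<longleftrightarrow>
      {\<beta>1, \<beta>2} \<in> root_subword_complex W S act \<alpha> (s # d)"
    using root_subword_complex_cong[OF d(1) cw(1)] d(2) cw(2) by simp
  also have "\<dots> \<longleftrightarrow>
      root_sigma S act \<alpha> s ` {\<beta>1, \<beta>2} \<in> root_subword_complex W S act \<alpha> (d @ [s])"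
    using root_subword_complex_rotate[OF d(1)] assms(8,9) by simp
  finally show ?thesis
    using root_subword_complex_cong[OF d'(1) cw'(1)] d'(2) cw'(2) by simp
qed

end
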